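(* Let $\mathcal A=((A,[\,,\,]_A),(V,\rho),T)$ and $\mathcal B=((B,[\,,\,]_B),(M,\nu_M),S)$ be relative Rota-Baxter Lie algebras over a field $k$, and let $0\to\mathcal B\xrightarrow{(\mathfrak i,i)}\hat{\mathcal A}\xrightarrow{(\mathfrak p,p)}\mathcal A\to0$ be an abelian extension of $\mathcal A$ by $\mathcal B$. Then there is an exact sequence $$0\longrightarrow\mathcal Z^1(\mathcal A,\mathcal B)\xrightarrow{\iota}\mathrm{Aut}_{\mathcal B}(\hat{\mathcal A})\xrightarrow{K}C_{(\mu,\rho_B,\rho_M)}\xrightarrow{W}\mathcal H^2(\mathcal A,\mathcal B).$$
   Context: A relative Rota-Baxter Lie algebra is a triple $((A,[\,,\,]_A),(V,\rho),T)$ where $(A,[\,,\,]_A)$ is a Lie algebra, $\rho:A\to\mathfrak{gl}(V)$ is a representation of $A$ on the vector space $V$, and $T:V\to A$ is a linear map with $[T(u),T(v)]_A=T(\rho(T(u))v-\rho(T(v))u)$ for all $u,v\in V$. It is abelian if $[\,,\,]_A=0$ and $\rho=0$. A homomorphism from $((A,[\,,\,]_A),(V,\rho),T)$ to $((A',[\,,\,]_{A'}),(V',\rho'),T')$ is a pair $(\varphi,\phi)$ with $\varphi:A\to A'$ a Lie algebra homomorphism and $\phi:V\to V'$ a linear map such that $T'\phi=\varphi T$ and $\phi(\rho(x)v)=\rho'(\varphi(x))\phi(v)$. $\mathrm{Aut}(\mathcal A)$ is the group of bijective homomorphisms $\mathcal A\to\mathcal A$. An abelian extension of $\mathcal A$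 by $\mathcal B$, where $\mathcal B$ is abelian, is a relative Rota-Baxter Lie algebra $\hat{\mathcal A}=((\hat A,[\,,\,]_{\hat A}),(\hat V,\hat\rho),\hat T)$ with homomorphisms $(\mathfrak i,i):\mathcal B\to\hat{\mathcal A}$ and $(\mathfrak p,p):\hat{\mathcal A}\to\mathcal A$ such that $0\to B\xrightarrow{\mathfrak i}\hat A\xrightarrow{\mathfrak p}A\to0$ and $0\to M\xrightarrow{i}\hat V\xrightarrow{p}V\to0$ are exact. $B$ and $M$ are identified with their images in $\hat A$ and $\hat V$. Fix a section $(\mathfrak s,s)$ of $(\mathfrak p,p)$, i.e. linear maps $\mathfrak s:A\to\hat A$, $s:V\to\hat V$ with $\mathfrak p\mathfrak s=\mathrm{id}_A$, $ps=\mathrm{id}_V$. The induced maps are $\omega(x,y)=[\mathfrak s(x),\mathfrak s(y)]_{\hat A}-\mathfrak s([x,y]_A)\in B$, $\varpi(x,v)=\hat\rho(\mathfrak s(x))s(v)-s(\rho(x)v)\in M$, $\chi(v)=\hat T(s(v))-\mathfrak s(T(v))\in B$, $\mu(v)a=-\hat\rho(a)s(v)\in M$, $\rho_B(x)a=[\mathfrak s(x),a]_{\hat A}\in B$, $\rho_M(x)m=\hat\rho(\mathfrak s(x))m\in M$. $\mathrm{Aut}_{\mathcal B}(\hat{\mathcal A})=\{\gamma=(\gamma_1,\gamma_2)\in\mathrm{Aut}(\hat{\mathcal A})\mid\gamma_1(B)\subseteq B,\gamma_2(M)\subseteq M\}$ and $K(\gamma)=((\mathfrak p\gamma_1\mathfrak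 s,p\gamma_2s),(\gamma_1|_B,\gamma_2|_M))$. $C_{(\mu,\rho_B,\rho_M)}$ is the set of pairs $(\alpha,\beta)\in\mathrm{Aut}(\mathcal A)\times\mathrm{Aut}(\mathcal B)$, $\alpha=(\alpha_1,\alpha_2)$, $\beta=(\beta_1,\beta_2)$, such that $\beta_1(\rho_B(x)a)=\rho_B(\alpha_1(x))\beta_1(a)$, $\beta_2(\rho_M(x)m)=\rho_M(\alpha_1(x))\beta_2(m)$, $\beta_2(\mu(v)a)=\mu(\alpha_2(v))\beta_1(a)$ for all $x\in A,a\in B,v\in V,m\in M$. Cohomology (coefficients in the representation $(M\xrightarrow{S}B,\rho_B,\rho_M,\mu)$): $\mathcal Z^1(\mathcal A,\mathcal B)$ is the space of pairs of linear maps $\varphi_B:A\to B$, $\varphi_M:V\to M$ with $\rho_B(x)\varphi_B(y)-\rho_B(y)\varphi_B(x)=\varphi_B([x,y]_A)$, $\mu(v)\varphi_B(x)+\varphi_M(\rho(x)v)=\rho_M(x)\varphi_M(v)$, $\varphi_B(Tv)=S\varphi_M(v)$ for all $x,y\in A$, $v\in V$. $\mathcal Z^2(\mathcal A,\mathcal B)$ is the space of $(f_B,f_M,\theta)\in\mathrm{Hom}(\wedge^2A,B)\oplus\mathrm{Hom}(A\otimes V,M)\oplus\mathrm{Hom}(V,B)$ such that for all $x,y,z\in A$, $v,v_1,v_2\in V$: $\rho_B(x)f_B(y,z)-\rho_B(y)f_B(x,z)+\rho_B(z)f_B(x,y)-f_B([x,y]_A,z)+f_B([x,z]_A,y)-f_B([y,z]_A,x)=0$;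 $-f_M([x,y]_A,v)+\mu(v)f_B(x,y)+\rho_M(x)f_M(y,v)-\rho_M(y)f_M(x,v)-f_M(y,\rho(x)v)+f_M(x,\rho(y)v)=0$; $\rho_B(Tv_1)\theta(v_2)-\rho_B(Tv_2)\theta(v_1)-S(\mu(v_1)\theta(v_2)-\mu(v_2)\theta(v_1))-\theta(\rho(Tv_1)v_2-\rho(Tv_2)v_1)+f_B(Tv_1,Tv_2)-S(f_M(Tv_1,v_2)-f_M(Tv_2,v_1))=0$. $\mathcal B^2(\mathcal A,\mathcal B)$ is the set of $((\delta\varphi)_B,(\delta\varphi)_M,h_T\varphi)$ with $\varphi_B:A\to B$, $\varphi_M:V\to M$ linear, $(\delta\varphi)_B(x,y)=\rho_B(x)\varphi_B(y)-\rho_B(y)\varphi_B(x)-\varphi_B([x,y]_A)$, $(\delta\varphi)_M(x,v)=-\mu(v)\varphi_B(x)+\rho_M(x)\varphi_M(v)-\varphi_M(\rho(x)v)$, $(h_T\varphi)(v)=-\varphi_B(Tv)+S\varphi_M(v)$. $\mathcal H^2(\mathcal A,\mathcal B)=\mathcal Z^2(\mathcal A,\mathcal B)/\mathcal B^2(\mathcal A,\mathcal B)$. The map $\iota$ sends $(\zeta,\eta)\in\mathcal Z^1(\mathcal A,\mathcal B)$ to $\gamma=(\gamma_1,\gamma_2)$ with $\gamma_1(\mathfrak s(x)+a)=\mathfrak s(x)+\zeta(x)+a$, $\gamma_2(s(v)+m)=s(v)+\eta(v)+m$. The Wells map is $W(\alpha,\beta)=[(\omega_{(\alpha,\beta)},\varpi_{(\alpha,\beta)},\chi_{(\alpha,\beta)})-(\omega,\varpi,\chi)]$,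 where $\omega_{(\alpha,\beta)}(x,y)=\beta_1\omega(\alpha_1^{-1}(x),\alpha_1^{-1}(y))$, $\varpi_{(\alpha,\beta)}(x,v)=\beta_2\varpi(\alpha_1^{-1}(x),\alpha_2^{-1}(v))$, $\chi_{(\alpha,\beta)}(v)=\beta_1\chi(\alpha_2^{-1}(v))$.
   Formalization: Aut_B(Â) is taken with γ_1(B)=B and γ_2(M)=M instead of inclusions; in infinite dimension inclusions do not make K(γ) a pair of automorphisms (a shift can map B properly into itself), and the two agree whenever K lands in C. *)

theory Defs
  imports Complex_Main "HOL-Algebra.Coset"
begin

section \<open>Relative Rota-Baxter Lie algebras\<close>

definition bilinear_map ::
  "('k::field \<Rightarrow> 'a::ab_group_add \<Rightarrow> 'a) \<Rightarrow> ('k \<Rightarrow> 'b::ab_group_add \<Rightarrow> 'b) \<Rightarrow>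
   ('k \<Rightarrow> 'c::ab_group_add \<Rightarrow> 'c) \<Rightarrow> ('a \<Rightarrow> 'b \<Rightarrow> 'c) \<Rightarrow> bool"
  where "bilinear_map s1 s2 s3 f \<longleftrightarrow>
    (\<forall>x. Vector_Spaces.linear s2 s3 (f x)) \<and> (\<forall>y. Vector_Spaces.linear s1 s3 (\<lambda>x. f x y))"

locale lie_algebra = vector_space scale
  for scale :: "'k::field \<Rightarrow> 'a::ab_group_add \<Rightarrow> 'a"
  and brk :: "'a \<Rightarrow> 'a \<Rightarrow> 'a" +
  assumes bilinear: "bilinear_map scale scale scale brk"
    and alternating: "brk x x = 0"
    and jacobi: "brk x (brk y z) + brk y (brk z x) + brk z (brk x y) = 0"

locale lie_representation = lie_algebra scale brk + module_space: vector_space scaleV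
  for scale :: "'k::field \<Rightarrow> 'a::ab_group_add \<Rightarrow> 'a"
  and brk :: "'a \<Rightarrow> 'a \<Rightarrow> 'a"
  and scaleV :: "'k \<Rightarrow> 'v::ab_group_add \<Rightarrow> 'v"
  and \<rho> :: "'a \<Rightarrow> 'v \<Rightarrow> 'v" +
  assumes rep_bilinear: "bilinear_map scale scaleV scaleV \<rho>"
    and rep_bracket: "\<rho> (brk x y) v = \<rho> x (\<rho> y v) - \<rho> y (\<rho> x v)"

text \<open>
  The vector spaces \<open>A\<close> and \<open>V\<close> are the types \<open>'a\<close> and \<open>'v\<close> with the given scalar
  multiplications; the remaining fields are the bracket, the representation and the operator
  \<open>T : V \<rightarrow> A\<close>.
\<close>

record ('k, 'a, 'v) rrb =
  scaleA :: "'k \<Rightarrow> 'a \<Rightarrow> 'a"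
  scaleV :: "'k \<Rightarrow> 'v \<Rightarrow> 'v"
  brk :: "'a \<Rightarrow> 'a \<Rightarrow> 'a"
  act :: "'a \<Rightarrow> 'v \<Rightarrow> 'v"
  oper :: "'v \<Rightarrow> 'a"

definition rrb_lie_algebra ::
  "('k::field, 'a::ab_group_add, 'v::ab_group_add) rrb \<Rightarrow> bool"
  where "rrb_lie_algebra R \<longleftrightarrow>
    lie_representation (scaleA R) (brk R) (scaleV R) (act R) \<and>
    Vector_Spaces.linear (scaleV R) (scaleA R) (oper R) \<and>
    (\<forall>u v. brk R (oper R u) (oper R v) =
       oper R (act R (oper R u) v - act R (oper R v) u))"

definition rrb_abelian :: "('k::field, 'a::ab_group_add, 'v::ab_group_add) rrb \<Rightarrow> bool"
  where "rrb_abelian R \<longleftrightarrow> (\<forall>x y. brk R x y = 0) \<and> (\<forall>x v. act R x v = 0)"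

definition rrb_hom ::
  "('k::field, 'a::ab_group_add, 'v::ab_group_add) rrb \<Rightarrow>
   ('k, 'b::ab_group_add, 'w::ab_group_add) rrb \<Rightarrow> (('a \<Rightarrow> 'b) \<times> ('v \<Rightarrow> 'w)) set"
  where "rrb_hom R R' = {(f, g).
    Vector_Spaces.linear (scaleA R) (scaleA R') f \<and>
    Vector_Spaces.linear (scaleV R) (scaleV R') g \<and>
    (\<forall>x y. f (brk R x y) = brk R' (f x) (f y)) \<and>
    (\<forall>v. oper R' (g v) = f (oper R v)) \<and>
    (\<forall>x v. g (act R x v) = act R' (f x) (g v))}"

definition rrb_Aut ::
  "('k::field, 'a::ab_group_add, 'v::ab_group_add) rrb \<Rightarrow> (('a \<Rightarrow> 'a) \<times> ('v \<Rightarrow> 'v)) monoid"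
  where "rrb_Aut R = \<lparr>carrier = {(f, g) \<in> rrb_hom R R. bij f \<and> bij g},
    mult = (\<lambda>(f, g) (f', g'). (f \<circ> f', g \<circ> g')), one = (id, id)\<rparr>"

section \<open>Cohomology\<close>

text \<open>
  Coefficients are taken in \<open>(M \<rightarrow> B, rB, rM, mu)\<close>, where the map \<open>S : M \<rightarrow> B\<close> and the vector space
  structures are those of the second argument \<open>B\<close>. Cochains form groups under pointwise addition.
\<close>

definition Z1 ::
  "('k::field, 'a::ab_group_add, 'v::ab_group_add) rrb \<Rightarrow>
   ('k, 'b::ab_group_add, 'm::ab_group_add) rrb \<Rightarrow>
   ('a \<Rightarrow> 'b \<Rightarrow> 'b) \<Rightarrow> ('a \<Rightarrow> 'm \<Rightarrow> 'm) \<Rightarrow> ('v \<Rightarrow> 'b \<Rightarrow> 'm) \<Rightarrow> (('a \<Rightarrow> 'b) \<times> ('v \<Rightarrow> 'm)) monoid"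
  where "Z1 A B rB rM mu = \<lparr>carrier = {(\<phi>B, \<phi>M).
      Vector_Spaces.linear (scaleA A) (scaleA B) \<phi>B \<and>
      Vector_Spaces.linear (scaleV A) (scaleV B) \<phi>M \<and>
      (\<forall>x y. rB x (\<phi>B y) - rB y (\<phi>B x) = \<phi>B (brk A x y)) \<and>
      (\<forall>x v. mu v (\<phi>B x) + \<phi>M (act A x v) = rM x (\<phi>M v)) \<and>
      (\<forall>v. \<phi>B (oper A v) = oper B (\<phi>M v))},
    mult = (\<lambda>(\<phi>B, \<phi>M) (\<psi>B, \<psi>M). (\<lambda>x. \<phi>B x + \<psi>B x, \<lambda>v. \<phi>M v + \<psi>M v)),
    one = (\<lambda>x. 0, \<lambda>v. 0)\<rparr>"

definition Z2 ::
  "('k::field, 'a::ab_group_add, 'v::ab_group_add) rrb \<Rightarrow>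
   ('k, 'b::ab_group_add, 'm::ab_group_add) rrb \<Rightarrow>
   ('a \<Rightarrow> 'b \<Rightarrow> 'b) \<Rightarrow> ('a \<Rightarrow> 'm \<Rightarrow> 'm) \<Rightarrow> ('v \<Rightarrow> 'b \<Rightarrow> 'm) \<Rightarrow>
   (('a \<Rightarrow> 'a \<Rightarrow> 'b) \<times> ('a \<Rightarrow> 'v \<Rightarrow> 'm) \<times> ('v \<Rightarrow> 'b)) monoid"
  where "Z2 A B rB rM mu = \<lparr>carrier = {(fB, fM, \<theta>).
      bilinear_map (scaleA A) (scaleA A) (scaleA B) fB \<and> (\<forall>x. fB x x = 0) \<and>
      bilinear_map (scaleA A) (scaleV A) (scaleV B) fM \<and>
      Vector_Spaces.linear (scaleV A) (scaleA B) \<theta> \<and>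
      (\<forall>x y z. rB x (fB y z) - rB y (fB x z) + rB z (fB x y)
          - fB (brk A x y) z + fB (brk A x z) y - fB (brk A y z) x = 0) \<and>
      (\<forall>x y v. - fM (brk A x y) v + mu v (fB x y) + rM x (fM y v) - rM y (fM x v)
          - fM y (act A x v) + fM x (act A y v) = 0) \<and>
      (\<forall>v1 v2. rB (oper A v1) (\<theta> v2) - rB (oper A v2) (\<theta> v1)
          - oper B (mu v1 (\<theta> v2) - mu v2 (\<theta> v1))
          - \<theta> (act A (oper A v1) v2 - act A (oper A v2) v1)
          + fB (oper A v1) (oper A v2)
          - oper B (fM (oper A v1) v2 - fM (oper A v2) v1) = 0)},
    mult = (\<lambda>(fB, fM, \<theta>) (gB, gM, \<eta>).
      (\<lambda>x y. fB x y + gB x y, \<lambda>x v. fM x v + gM x v, \<lambda>v. \<theta> v + \<eta> v)),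
    one = (\<lambda>x y. 0, \<lambda>x v. 0, \<lambda>v. 0)\<rparr>"

definition B2 ::
  "('k::field, 'a::ab_group_add, 'v::ab_group_add) rrb \<Rightarrow>
   ('k, 'b::ab_group_add, 'm::ab_group_add) rrb \<Rightarrow>
   ('a \<Rightarrow> 'b \<Rightarrow> 'b) \<Rightarrow> ('a \<Rightarrow> 'm \<Rightarrow> 'm) \<Rightarrow> ('v \<Rightarrow> 'b \<Rightarrow> 'm) \<Rightarrow>
   (('a \<Rightarrow> 'a \<Rightarrow> 'b) \<times> ('a \<Rightarrow> 'v \<Rightarrow> 'm) \<times> ('v \<Rightarrow> 'b)) set"
  where "B2 A B rB rM mu =
    {(\<lambda>x y. rB x (\<phi>B y) - rB y (\<phi>B x) - \<phi>B (brk A x y),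
      \<lambda>x v. - mu v (\<phi>B x) + rM x (\<phi>M v) - \<phi>M (act A x v),
      \<lambda>v. - \<phi>B (oper A v) + oper B (\<phi>M v)) | \<phi>B \<phi>M.
      Vector_Spaces.linear (scaleA A) (scaleA B) \<phi>B \<and>
      Vector_Spaces.linear (scaleV A) (scaleV B) \<phi>M}"

definition H2 ::
  "('k::field, 'a::ab_group_add, 'v::ab_group_add) rrb \<Rightarrow>
   ('k, 'b::ab_group_add, 'm::ab_group_add) rrb \<Rightarrow>
   ('a \<Rightarrow> 'b \<Rightarrow> 'b) \<Rightarrow> ('a \<Rightarrow> 'm \<Rightarrow> 'm) \<Rightarrow> ('v \<Rightarrow> 'b \<Rightarrow> 'm) \<Rightarrow>
   (('a \<Rightarrow> 'a \<Rightarrow> 'b) \<times> ('a \<Rightarrow> 'v \<Rightarrow> 'm) \<times> ('v \<Rightarrow> 'b)) set monoid"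
  where "H2 A B rB rM mu = Z2 A B rB rM mu Mod B2 A B rB rM mu"

section \<open>Abelian extensions\<close>

definition abelian_extension ::
  "('k::field, 'a::ab_group_add, 'v::ab_group_add) rrb \<Rightarrow>
   ('k, 'b::ab_group_add, 'm::ab_group_add) rrb \<Rightarrow>
   ('k, 'e::ab_group_add, 'w::ab_group_add) rrb \<Rightarrow>
   ('b \<Rightarrow> 'e) \<Rightarrow> ('m \<Rightarrow> 'w) \<Rightarrow> ('e \<Rightarrow> 'a) \<Rightarrow> ('w \<Rightarrow> 'v) \<Rightarrow> bool"
  where "abelian_extension A B E iA iV pA pV \<longleftrightarrow>
    rrb_lie_algebra A \<and> rrb_lie_algebra B \<and> rrb_abelian B \<and> rrb_lie_algebra E \<and>
    (iA, iV) \<in> rrb_hom B E \<and> (pA, pV) \<in> rrb_hom E A \<and>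
    inj iA \<and> range iA = {x. pA x = 0} \<and> surj pA \<and>
    inj iV \<and> range iV = {w. pV w = 0} \<and> surj pV"

definition linear_section ::
  "('k::field, 'a::ab_group_add, 'v::ab_group_add) rrb \<Rightarrow>
   ('k, 'e::ab_group_add, 'w::ab_group_add) rrb \<Rightarrow>
   ('e \<Rightarrow> 'a) \<Rightarrow> ('w \<Rightarrow> 'v) \<Rightarrow> ('a \<Rightarrow> 'e) \<Rightarrow> ('v \<Rightarrow> 'w) \<Rightarrow> bool"
  where "linear_section A E pA pV sA sV \<longleftrightarrow>
    Vector_Spaces.linear (scaleA A) (scaleA E) sA \<and>
    Vector_Spaces.linear (scaleV A) (scaleV E) sV \<and>
    (\<forall>x. pA (sA x) = x) \<and> (\<forall>v. pV (sV v) = v)"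

text \<open>
  The induced maps take values in the kernels \<open>iA B\<close> and \<open>iV M\<close>; they are transported to \<open>B\<close> and
  \<open>M\<close> by the inverses of the injections \<open>iA\<close> and \<open>iV\<close>. HOL-Algebra overloads the notation
  for inverses, hence \<open>inv_into UNIV\<close> throughout.
\<close>

definition ext_\<omega> ::
  "('k, 'a, 'v) rrb \<Rightarrow> ('k, 'e::ab_group_add, 'w) rrb \<Rightarrow> ('b \<Rightarrow> 'e) \<Rightarrow> ('a \<Rightarrow> 'e) \<Rightarrow> 'a \<Rightarrow> 'a \<Rightarrow> 'b"
  where "ext_\<omega> A E iA sA x y = inv_into UNIV iA (brk E (sA x) (sA y) - sA (brk A x y))"

definition ext_varpi ::
  "('k, 'a, 'v) rrb \<Rightarrow> ('k, 'e, 'w::ab_group_add) rrb \<Rightarrow> ('m \<Rightarrow> 'w) \<Rightarrow> ('a \<Rightarrow> 'e) \<Rightarrow> ('v \<Rightarrow> 'w) \<Rightarrow>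
   'a \<Rightarrow> 'v \<Rightarrow> 'm"
  where "ext_varpi A E iV sA sV x v = inv_into UNIV iV (act E (sA x) (sV v) - sV (act A x v))"

definition ext_\<chi> ::
  "('k, 'a, 'v) rrb \<Rightarrow> ('k, 'e::ab_group_add, 'w) rrb \<Rightarrow> ('b \<Rightarrow> 'e) \<Rightarrow> ('a \<Rightarrow> 'e) \<Rightarrow> ('v \<Rightarrow> 'w) \<Rightarrow>
   'v \<Rightarrow> 'b"
  where "ext_\<chi> A E iA sA sV v = inv_into UNIV iA (oper E (sV v) - sA (oper A v))"

definition ext_\<mu> ::
  "('k, 'e, 'w::ab_group_add) rrb \<Rightarrow> ('b \<Rightarrow> 'e) \<Rightarrow> ('m \<Rightarrow> 'w) \<Rightarrow> ('v \<Rightarrow> 'w) \<Rightarrow> 'v \<Rightarrow> 'b \<Rightarrow> 'm"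
  where "ext_\<mu> E iA iV sV v a = inv_into UNIV iV (- act E (iA a) (sV v))"

definition ext_\<rho>B :: "('k, 'e, 'w) rrb \<Rightarrow> ('b \<Rightarrow> 'e) \<Rightarrow> ('a \<Rightarrow> 'e) \<Rightarrow> 'a \<Rightarrow> 'b \<Rightarrow> 'b"
  where "ext_\<rho>B E iA sA x a = inv_into UNIV iA (brk E (sA x) (iA a))"

definition ext_\<rho>M :: "('k, 'e, 'w) rrb \<Rightarrow> ('m \<Rightarrow> 'w) \<Rightarrow> ('a \<Rightarrow> 'e) \<Rightarrow> 'a \<Rightarrow> 'm \<Rightarrow> 'm"
  where "ext_\<rho>M E iV sA x m = inv_into UNIV iV (act E (sA x) (iV m))"

section \<open>The groups and maps of the Wells sequence\<close>

text \<open>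
  The stabiliser of \<open>(B, M)\<close> is formed with equalities \<open>\<gamma>\<^sub>1(B) = B\<close> and \<open>\<gamma>\<^sub>2(M) = M\<close>. In infinite
  dimension the inclusions alone neither define a group nor make \<open>K \<gamma>\<close> a pair of automorphisms
  (a shift operator may map \<open>B\<close> properly into itself); if \<open>B\<close> and \<open>M\<close> are finite dimensional,
  inclusions suffice, see \<open>carrier_Aut_ext_finite_dim\<close> below.
\<close>

definition Aut_ext ::
  "('k::field, 'e::ab_group_add, 'w::ab_group_add) rrb \<Rightarrow> ('b \<Rightarrow> 'e) \<Rightarrow> ('m \<Rightarrow> 'w) \<Rightarrow>
   (('e \<Rightarrow> 'e) \<times> ('w \<Rightarrow> 'w)) monoid"
  where "Aut_ext E iA iV = (rrb_Aut E)\<lparr>carrier :=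
    {(\<gamma>1, \<gamma>2) \<in> carrier (rrb_Aut E).
       \<gamma>1 ` range iA = range iA \<and> \<gamma>2 ` range iV = range iV}\<rparr>"

definition compatible_pairs ::
  "('k::field, 'a::ab_group_add, 'v::ab_group_add) rrb \<Rightarrow>
   ('k, 'b::ab_group_add, 'm::ab_group_add) rrb \<Rightarrow>
   ('a \<Rightarrow> 'b \<Rightarrow> 'b) \<Rightarrow> ('a \<Rightarrow> 'm \<Rightarrow> 'm) \<Rightarrow> ('v \<Rightarrow> 'b \<Rightarrow> 'm) \<Rightarrow>
   ((('a \<Rightarrow> 'a) \<times> ('v \<Rightarrow> 'v)) \<times> (('b \<Rightarrow> 'b) \<times> ('m \<Rightarrow> 'm))) monoid"
  where "compatible_pairs A B rB rM mu = (rrb_Aut A \<times>\<times> rrb_Aut B)\<lparr>carrier :=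
    {((\<alpha>1, \<alpha>2), (\<beta>1, \<beta>2)) \<in> carrier (rrb_Aut A \<times>\<times> rrb_Aut B).
       (\<forall>x a. \<beta>1 (rB x a) = rB (\<alpha>1 x) (\<beta>1 a)) \<and>
       (\<forall>x m. \<beta>2 (rM x m) = rM (\<alpha>1 x) (\<beta>2 m)) \<and>
       (\<forall>v a. \<beta>2 (mu v a) = mu (\<alpha>2 v) (\<beta>1 a))}\<rparr>"

definition K_map ::
  "('b \<Rightarrow> 'e) \<Rightarrow> ('m \<Rightarrow> 'w) \<Rightarrow> ('e \<Rightarrow> 'a) \<Rightarrow> ('w \<Rightarrow> 'v) \<Rightarrow> ('a \<Rightarrow> 'e) \<Rightarrow> ('v \<Rightarrow> 'w) \<Rightarrow>
   ('e \<Rightarrow> 'e) \<times> ('w \<Rightarrow> 'w) \<Rightarrow> (('a \<Rightarrow> 'a) \<times> ('v \<Rightarrow> 'v)) \<times> (('b \<Rightarrow> 'b) \<times> ('m \<Rightarrow> 'm))"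
  where "K_map iA iV pA pV sA sV = (\<lambda>(\<gamma>1, \<gamma>2).
    ((pA \<circ> \<gamma>1 \<circ> sA, pV \<circ> \<gamma>2 \<circ> sV),
     (inv_into UNIV iA \<circ> \<gamma>1 \<circ> iA, inv_into UNIV iV \<circ> \<gamma>2 \<circ> iV)))"

text \<open>
  Every \<open>e\<close> is uniquely \<open>s(x) + a\<close> with \<open>x = p(e)\<close> and \<open>a = e - s(p(e))\<close> in \<open>B\<close>, so the
  following is the map \<open>s(x) + a \<mapsto> s(x) + \<zeta>(x) + a\<close>; see \<open>\<iota>_map_apply\<close>.
\<close>

definition \<iota>_map ::
  "('b \<Rightarrow> 'e::ab_group_add) \<Rightarrow> ('m \<Rightarrow> 'w::ab_group_add) \<Rightarrow> ('e \<Rightarrow> 'a) \<Rightarrow> ('w \<Rightarrow> 'v) \<Rightarrow>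
   ('a \<Rightarrow> 'e) \<Rightarrow> ('v \<Rightarrow> 'w) \<Rightarrow> ('a \<Rightarrow> 'b) \<times> ('v \<Rightarrow> 'm) \<Rightarrow> ('e \<Rightarrow> 'e) \<times> ('w \<Rightarrow> 'w)"
  where "\<iota>_map iA iV pA pV sA sV = (\<lambda>(\<zeta>, \<eta>).
    (\<lambda>e. sA (pA e) + iA (\<zeta> (pA e)) + (e - sA (pA e)),
     \<lambda>w. sV (pV w) + iV (\<eta> (pV w)) + (w - sV (pV w))))"

definition Wells_map ::
  "('k::field, 'a::ab_group_add, 'v::ab_group_add) rrb \<Rightarrow>
   ('k, 'b::ab_group_add, 'm::ab_group_add) rrb \<Rightarrow>
   ('a \<Rightarrow> 'b \<Rightarrow> 'b) \<Rightarrow> ('a \<Rightarrow> 'm \<Rightarrow> 'm) \<Rightarrow> ('v \<Rightarrow> 'b \<Rightarrow> 'm) \<Rightarrow>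
   ('a \<Rightarrow> 'a \<Rightarrow> 'b) \<Rightarrow> ('a \<Rightarrow> 'v \<Rightarrow> 'm) \<Rightarrow> ('v \<Rightarrow> 'b) \<Rightarrow>
   (('a \<Rightarrow> 'a) \<times> ('v \<Rightarrow> 'v)) \<times> (('b \<Rightarrow> 'b) \<times> ('m \<Rightarrow> 'm)) \<Rightarrow>
   (('a \<Rightarrow> 'a \<Rightarrow> 'b) \<times> ('a \<Rightarrow> 'v \<Rightarrow> 'm) \<times> ('v \<Rightarrow> 'b)) set"
  where "Wells_map A B rB rM mu \<omega> varpi \<chi> = (\<lambda>((\<alpha>1, \<alpha>2), (\<beta>1, \<beta>2)).
    B2 A B rB rM mu #>\<^bsub>Z2 A B rB rM mu\<^esub>
      (\<lambda>x y. \<beta>1 (\<omega> (inv_into UNIV \<alpha>1 x) (inv_into UNIV \<alpha>1 y)) - \<omega> x y,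
       \<lambda>x v. \<beta>2 (varpi (inv_into UNIV \<alpha>1 x) (inv_into UNIV \<alpha>2 v)) - varpi x v,
       \<lambda>v. \<beta>1 (\<chi> (inv_into UNIV \<alpha>2 v)) - \<chi> v))"

section \<open>Consistency of the encodings\<close>

lemma linear_0_add:
  assumes "Vector_Spaces.linear s t f"
  shows "f 0 = 0" "f (x + y) = f x + f y"
proof -
  interpret Vector_Spaces.linear s t f by fact
  show "f 0 = 0" "f (x + y) = f x + f y" by (simp_all add: zero add)
qed

lemma \<iota>_map_apply:
  assumes ext: "abelian_extension A B E iA iV pA pV"
    and sec: "linear_section A E pA pV sA sV"
  shows "fst (\<iota>_map iA iV pA pV sA sV (\<zeta>, \<eta>)) (sA x + iA a) = sA x + iA (\<zeta> x) + iA a"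
    and "snd (\<iota>_map iA iV pA pV sA sV (\<zeta>, \<eta>)) (sV v + iV m) = sV v + iV (\<eta> v) + iV m"
proof -
  have l: "Vector_Spaces.linear (scaleA E) (scaleA A) pA"
      "Vector_Spaces.linear (scaleV E) (scaleV A) pV"
    using ext unfolding abelian_extension_def rrb_hom_def by auto
  have k: "pA (iA a) = 0" "pV (iV m) = 0"
    using ext unfolding abelian_extension_def by auto
  have s: "pA (sA x) = x" "pV (sV v) = v"
    using sec unfolding linear_section_def by auto
  have "pA (sA x + iA a) = x" "pV (sV v + iV m) = v"
    using linear_0_add[OF l(1)] linear_0_add[OF l(2)] k s by auto
  then show "fst (\<iota>_map iA iV pA pV sA sV (\<zeta>, \<eta>)) (sA x + iA a) = sA x + iA (\<zeta> x) + iA a"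
    and "snd (\<iota>_map iA iV pA pV sA sV (\<zeta>, \<eta>)) (sV v + iV m) = sV v + iV (\<eta> v) + iV m"
    by (simp_all add: \<iota>_map_def)
qed

lemma finite_dim_inj_invariant:
  fixes s :: "'k::field \<Rightarrow> 'b::ab_group_add \<Rightarrow> 'b"
  assumes i: "Vector_Spaces.linear s t i" "inj i" and g: "Vector_Spaces.linear t t g" "inj g"
    and sub: "g ` range i \<subseteq> range i" and fin: "finite S" "module.span s S = UNIV"
  shows "g ` range i = range i"
proof -
  interpret i: Vector_Spaces.linear s t i by fact
  interpret g: Vector_Spaces.linear t t g by fact
  obtain Bs where Bs: "Bs \<subseteq> S" "i.vs1.independent Bs" "S \<subseteq> i.vs1.span Bs"
    using i.vs1.maximal_independent_subset[of S] by blast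
  have "i.vs1.span Bs = UNIV"
    using i.vs1.span_minimal[OF Bs(3) i.vs1.subspace_span] fin(2) by auto
  then interpret finite_dimensional_vector_space s Bs
    using Bs fin(1) finite_subset by unfold_locales auto
  define h where "h = inv_into UNIV i \<circ> g \<circ> i"
  have ih: "i (h b) = g (i b)" for b
    unfolding h_def using sub by (auto intro!: f_inv_into_f)
  have "Vector_Spaces.linear s s h"
  proof unfold_locales
    fix x y c
    show "h (x + y) = h x + h y"
      by (rule injD[OF i(2)]) (simp add: ih i.add g.add)
    show "h (s c x) = s c (h x)"
      by (rule injD[OF i(2)]) (simp add: ih i.scale g.scale)
  qed
  moreover have "inj h"
    by (rule injI) (metis ih i(2) g(2) injD)
  ultimately have "surj h" by (rule linear_inj_imp_surj)
  have "i b \<in> g ` range i" for b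
  proof -
    obtain c where "b = h c" using \<open>surj h\<close> by (meson surjD)
    then show ?thesis using ih[of c] by auto
  qed
  with sub show ?thesis by auto
qed

lemma carrier_Aut_ext_finite_dim:
  assumes ext: "abelian_extension A B E iA iV pA pV"
    and fin: "finite S" "module.span (scaleA B) S = UNIV"
      "finite S'" "module.span (scaleV B) S' = UNIV"
  shows "carrier (Aut_ext E iA iV) =
    {(\<gamma>1, \<gamma>2) \<in> carrier (rrb_Aut E). \<gamma>1 ` range iA \<subseteq> range iA \<and> \<gamma>2 ` range iV \<subseteq> range iV}"
proof -
  have i: "Vector_Spaces.linear (scaleA B) (scaleA E) iA" "inj iA"
      "Vector_Spaces.linear (scaleV B) (scaleV E) iV" "inj iV"
    using ext unfolding abelian_extension_def rrb_hom_def by auto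
  have "\<gamma>1 ` range iA = range iA \<and> \<gamma>2 ` range iV = range iV"
    if "(\<gamma>1, \<gamma>2) \<in> carrier (rrb_Aut E)" "\<gamma>1 ` range iA \<subseteq> range iA" "\<gamma>2 ` range iV \<subseteq> range iV"
    for \<gamma>1 \<gamma>2
  proof -
    have g: "Vector_Spaces.linear (scaleA E) (scaleA E) \<gamma>1" "inj \<gamma>1"
      "Vector_Spaces.linear (scaleV E) (scaleV E) \<gamma>2" "inj \<gamma>2"
      using that(1) by (simp_all add: rrb_Aut_def rrb_hom_def bij_def)
    show ?thesis
      using finite_dim_inj_invariant[OF i(1,2) g(1,2) that(2) fin(1,2)]
        finite_dim_inj_invariant[OF i(3,4) g(3,4) that(3) fin(3,4)] ..
  qed
  then have "x \<in> carrier (Aut_ext E iA iV) \<longleftrightarrow>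
    x \<in> {(\<gamma>1, \<gamma>2) \<in> carrier (rrb_Aut E). \<gamma>1 ` range iA \<subseteq> range iA \<and> \<gamma>2 ` range iV \<subseteq> range iV}" for x
    by (cases x) (simp add: Aut_ext_def, metis order_refl)
  then show ?thesis by blast
qed

end

theory Submission
  imports Defs
begin

text \<open>
  A section splits \<open>E\<close> as \<open>A \<oplus> B\<close> and \<open>V \<oplus> M\<close>, with the structure maps of \<open>E\<close> expressed through the
  action of \<open>A\<close> on \<open>B\<close> and the cocycle \<open>(\<omega>, varpi, \<chi>)\<close>. An automorphism preserving \<open>B\<close> is then a
  lower triangular matrix whose diagonal \<open>(\<alpha>, \<beta>)\<close> is its image under \<open>K\<close>, and whose
  off-diagonal entry \<open>\<phi>\<close> is a 1-cochain. Comparing coordinates, such a matrix is a homomorphism iff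
  \<open>(\<alpha>, \<beta>)\<close> is compatible and the coboundary of \<open>\<phi> \<alpha>\<inverse>\<close> is the cocycle transported along \<open>(\<alpha>, \<beta>)\<close>
  minus the original one. For \<open>\<alpha> = \<beta> = id\<close> this says that \<open>\<phi>\<close> is a 1-cocycle, which is exactness at
  \<open>Aut_ext\<close>; existence of \<open>\<phi>\<close> is the vanishing of the Wells class.
\<close>

section \<open>Linear and bilinear maps over explicitly given scalar multiplications\<close>

lemma linear_mapD:
  assumes "Vector_Spaces.linear s t f"
  shows "f 0 = 0" "f (x + y) = f x + f y" "f (- x) = - f x" "f (x - y) = f x - f y"
    "f (s c x) = t c (f x)" "vector_space s" "vector_space t"
proof -
  interpret Vector_Spaces.linear s t f by fact
  show "f 0 = 0" "f (x + y) = f x + f y" "f (- x) = - f x" "f (x - y) = f x - f y"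
    "f (s c x) = t c (f x)"
    by (simp_all add: zero add neg diff scale)
  show "vector_space s" "vector_space t" by unfold_locales
qed

lemma linear_mapI:
  assumes "vector_space s" "vector_space t"
    and "\<And>x y. f (x + y) = f x + f y" "\<And>c x. f (s c x) = t c (f x)"
  shows "Vector_Spaces.linear s t f"
  using assms by (simp add: Vector_Spaces.linear_iff)

lemma bilinear_mapD:
  assumes "bilinear_map s t u f"
  shows "f 0 y = 0" "f (x + x') y = f x y + f x' y" "f (- x) y = - f x y"
    "f (x - x') y = f x y - f x' y" "f (s c x) y = u c (f x y)"
    "f x 0 = 0" "f x (y + y') = f x y + f x y'" "f x (- y) = - f x y"
    "f x (y - y') = f x y - f x y'" "f x (t c y) = u c (f x y)"
  using assms linear_mapD(1-5)[of t u "f x"] linear_mapD(1-5)[of s u "\<lambda>x. f x y"]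
  unfolding bilinear_map_def by auto

lemma bilinear_mapI:
  assumes "vector_space s" "vector_space t" "vector_space u"
    and "\<And>x x' y. f (x + x') y = f x y + f x' y" "\<And>c x y. f (s c x) y = u c (f x y)"
    and "\<And>x y y'. f x (y + y') = f x y + f x y'" "\<And>c x y. f x (t c y) = u c (f x y)"
  shows "bilinear_map s t u f"
  using assms unfolding bilinear_map_def by (auto intro!: linear_mapI)

lemma scale_simps:
  assumes "vector_space s"
  shows "s c (x + y) = s c x + s c y" "s c (x - y) = s c x - s c y" "s c (- x) = - s c x"
    "s c 0 = 0"
proof -
  interpret vector_space s by fact
  show "s c (x + y) = s c x + s c y" "s c (x - y) = s c x - s c y" "s c (- x) = - s c x" "s c 0 = 0"
    by (simp_all add: algebra_simps)
qed

section \<open>Relative Rota-Baxter Lie algebras and their automorphism groups\<close>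

lemma rrb_lie_algebraD:
  assumes "rrb_lie_algebra R"
  shows "vector_space (scaleA R)" "vector_space (scaleV R)"
    "bilinear_map (scaleA R) (scaleA R) (scaleA R) (brk R)"
    "bilinear_map (scaleA R) (scaleV R) (scaleV R) (act R)"
    "Vector_Spaces.linear (scaleV R) (scaleA R) (oper R)"
    "brk R x x = 0" "brk R x y = - brk R y x"
    "brk R x (brk R y z) + brk R y (brk R z x) + brk R z (brk R x y) = 0"
    "act R (brk R x y) v = act R x (act R y v) - act R y (act R x v)"
    "brk R (oper R u) (oper R v) = oper R (act R (oper R u) v) - oper R (act R (oper R v) u)"
proof -
  interpret lie_representation "scaleA R" "brk R" "scaleV R" "act R"
    using assms by (simp add: rrb_lie_algebra_def)
  show "vector_space (scaleA R)" "vector_space (scaleV R)" by unfold_locales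
  show "bilinear_map (scaleA R) (scaleA R) (scaleA R) (brk R)"
    "bilinear_map (scaleA R) (scaleV R) (scaleV R) (act R)"
    by (fact bilinear rep_bilinear)+
  show T: "Vector_Spaces.linear (scaleV R) (scaleA R) (oper R)"
    using assms by (simp add: rrb_lie_algebra_def)
  show "brk R x x = 0" by (fact alternating)
  \<comment> \<open>Antisymmetry comes from polarising \<open>brk R x x = 0\<close>, in any
    characteristic.\<close>
  have "brk R (x + y) (x + y) = brk R x x + brk R y x + (brk R x y + brk R y y)"
    by (simp only: bilinear_mapD(2,7)[OF bilinear])
  then have "brk R y x + brk R x y = 0" by (simp only: alternating add_0_left add_0_right)
  then show "brk R x y = - brk R y x" by (simp only: eq_neg_iff_add_eq_0 add.commute)
  show "brk R x (brk R y z) + brk R y (brk R z x) + brk R z (brk R x y) = 0" by (fact jacobi)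
  show "act R (brk R x y) v = act R x (act R y v) - act R y (act R x v)" by (fact rep_bracket)
  show "brk R (oper R u) (oper R v) = oper R (act R (oper R u) v) - oper R (act R (oper R v) u)"
    using assms by (simp add: rrb_lie_algebra_def linear_mapD[OF T])
qed

lemma rrb_homD:
  assumes "(f, g) \<in> rrb_hom R R'"
  shows "Vector_Spaces.linear (scaleA R) (scaleA R') f"
    "Vector_Spaces.linear (scaleV R) (scaleV R') g"
    "f (brk R x y) = brk R' (f x) (f y)" "f (oper R v) = oper R' (g v)"
    "g (act R x v) = act R' (f x) (g v)"
  using assms by (auto simp: rrb_hom_def)

lemma linear_map_inv:
  assumes f: "Vector_Spaces.linear s s f" and "bij f"
  shows "Vector_Spaces.linear s s (inv_into UNIV f)"
proof (rule linear_mapI)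
  show "vector_space s" "vector_space s" by (rule linear_mapD[OF f])+
  have [simp]: "f (inv_into UNIV f y) = y" "inv_into UNIV f (f y) = y" for y
    using assms(2) by (simp_all add: bij_def surj_f_inv_f)
  \<comment> \<open>An identity for the inverse map thus reduces to one for \<open>f\<close>, where
    linearity applies.\<close>
  have *: "inv_into UNIV f y = x" if "y = f x" for x y
    using that by simp
  show "inv_into UNIV f (x + y) = inv_into UNIV f x + inv_into UNIV f y"
    "inv_into UNIV f (s c x) = s c (inv_into UNIV f x)" for x y c
    by (rule *, simp add: linear_mapD[OF f])+
qed

lemma mem_rrb_Aut:
  "(f, g) \<in> carrier (rrb_Aut R) \<longleftrightarrow> (f, g) \<in> rrb_hom R R \<and> bij f \<and> bij g"
  by (simp add: rrb_Aut_def)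

lemma rrb_Aut_simps [simp]:
  "(f, g) \<otimes>\<^bsub>rrb_Aut R\<^esub> (f', g') = (f \<circ> f', g \<circ> g')" "\<one>\<^bsub>rrb_Aut R\<^esub> = (id, id)"
  by (simp_all add: rrb_Aut_def)

lemma rrb_hom_comp:
  "(f, g) \<in> rrb_hom R R' \<Longrightarrow> (f', g') \<in> rrb_hom R' R'' \<Longrightarrow> (f' \<circ> f, g' \<circ> g) \<in> rrb_hom R R''"
  by (auto simp: rrb_hom_def intro: Vector_Spaces.linear_compose)

lemma rrb_Aut_inv:
  assumes "(f, g) \<in> carrier (rrb_Aut R)"
  shows "(inv_into UNIV f, inv_into UNIV g) \<in> carrier (rrb_Aut R)"
proof -
  have h: "(f, g) \<in> rrb_hom R R" and b: "bij f" "bij g"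
    using assms by (simp_all add: mem_rrb_Aut)
  have [simp]: "f (inv_into UNIV f y) = y" "inv_into UNIV f (f y) = y"
    "g (inv_into UNIV g z) = z" "inv_into UNIV g (g z) = z" for y z
    using b by (simp_all add: bij_def surj_f_inv_f)
  have *: "inv_into UNIV f y = x" if "y = f x" for x y
    using that by simp
  have **: "inv_into UNIV g y = x" if "y = g x" for x y
    using that by simp
  have "inv_into UNIV f (brk R x y) = brk R (inv_into UNIV f x) (inv_into UNIV f y)"
    "inv_into UNIV f (oper R v) = oper R (inv_into UNIV g v)"
    "inv_into UNIV g (act R x v) = act R (inv_into UNIV f x) (inv_into UNIV g v)" for x y v
    by (rule * **; simp add: rrb_homD[OF h])+
  then show ?thesis
    using b linear_map_inv rrb_homD(1,2)[OF h]
    by (auto simp: mem_rrb_Aut bij_betw_inv_into, auto simp: rrb_hom_def)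
qed

lemma linear_map_id: "vector_space s \<Longrightarrow> Vector_Spaces.linear s s id"
  by (rule linear_mapI) auto

lemma group_rrb_Aut:
  assumes "rrb_lie_algebra R"
  shows "group (rrb_Aut R)"
proof (rule groupI)
  show "\<one>\<^bsub>rrb_Aut R\<^esub> \<in> carrier (rrb_Aut R)"
    using rrb_lie_algebraD(1,2)[OF assms, THEN linear_map_id]
    by (auto simp: mem_rrb_Aut rrb_hom_def)
  show "x \<otimes>\<^bsub>rrb_Aut R\<^esub> y \<in> carrier (rrb_Aut R)"
    if "x \<in> carrier (rrb_Aut R)" "y \<in> carrier (rrb_Aut R)" for x y
    using that by (cases x; cases y) (auto simp: mem_rrb_Aut intro: rrb_hom_comp bij_comp)
  show "\<exists>y\<in>carrier (rrb_Aut R). y \<otimes>\<^bsub>rrb_Aut R\<^esub> x = \<one>\<^bsub>rrb_Aut R\<^esub>"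
    if "x \<in> carrier (rrb_Aut R)" for x
  proof (cases x)
    case (Pair f g)
    then show ?thesis
      using that rrb_Aut_inv[of f g R]
      by (intro bexI[of _ "(inv_into UNIV f, inv_into UNIV g)"]) (auto simp: mem_rrb_Aut bij_def)
  qed
qed (auto simp: rrb_Aut_def comp_assoc)

lemma inv_rrb_Aut:
  assumes "rrb_lie_algebra R" "(f, g) \<in> carrier (rrb_Aut R)"
  shows "inv\<^bsub>rrb_Aut R\<^esub> (f, g) = (inv_into UNIV f, inv_into UNIV g)"
  using assms rrb_Aut_inv[of f g R]
  by (intro group.inv_equality[OF group_rrb_Aut]) (auto simp: mem_rrb_Aut bij_def)

text \<open>Gives closure of the stabiliser under inverses. Equality matters here: if
  \<open>f\<close> maps \<open>S\<close> properly into itself, its inverse does not preserve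
  \<open>S\<close>.\<close>

lemma image_inv_eq: "bij f \<Longrightarrow> f ` S = S \<Longrightarrow> inv_into UNIV f ` S = S"
  by (metis bij_is_inj image_inv_f_f)

lemma image_comp_eq: "f ` S = S \<Longrightarrow> g ` S = S \<Longrightarrow> (f \<circ> g) ` S = S"
  by (metis image_comp)

text \<open>Both sides of each equivalence assert that the same difference vanishes. The left forms
  are those of \<open>liftable\<close>, the right forms those of an obstruction equal to a
  coboundary.\<close>

lemma group_eq_rearrange:
  fixes f :: "'z::ab_group_add"
  shows "f = w - b + r - s \<longleftrightarrow> b - w = r - s - f" "f = w - b + s \<longleftrightarrow> b - w = - f + s"
proof -
  have *: "f - (w - b + r - s) = b - w - (r - s - f)" "f - (w - b + s) = b - w - (- f + s)"
    by (simp_all add: algebra_simps)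
  show "f = w - b + r - s \<longleftrightarrow> b - w = r - s - f" "f = w - b + s \<longleftrightarrow> b - w = - f + s"
    by (metis * eq_iff_diff_eq_0)+
qed

text \<open>A bijection carrying the kernel of \<open>p\<close> onto itself induces bijections on
  the quotient and on the kernel. That it is onto the kernel is used twice: for injectivity of
  \<open>\<alpha>\<close>, as an element mapped into the kernel must already lie there, and for
  surjectivity of \<open>\<beta>\<close>.\<close>

lemma bij_diagonal:
  fixes g :: "'x::group_add \<Rightarrow> 'x" and p :: "'x \<Rightarrow> 'y::group_add"
  assumes "bij g" and i: "inj i" "g ` range i = range i" "\<And>a. i (\<beta> a) = g (i a)"
    and p: "range i = {e. p e = 0}" "surj p" "\<And>e. p (g e) = \<alpha> (p e)"
    and diff: "\<And>e f. g (e - f) = g e - g f" "\<And>e f. p (e - f) = p e - p f"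
  shows "bij \<alpha>" "bij \<beta>"
proof -
  show "bij \<alpha>"
  proof (rule bijI)
    have "\<exists>x. y = \<alpha> x" for y
    proof -
      obtain e where "y = p e" using p(2) by (metis surjD)
      moreover obtain f where "e = g f" using bij_is_surj[OF \<open>bij g\<close>] by (metis surjD)
      ultimately show ?thesis using p(3) by auto
    qed
    then show "surj \<alpha>" by (simp add: surj_def)
    show "inj \<alpha>"
    proof (rule injI)
      fix x y assume eq: "\<alpha> x = \<alpha> y"
      obtain e f where ef: "x = p e" "y = p f" using p(2) by (metis surjD)
      then have "p (g (e - f)) = 0" using eq p(3) by (simp add: diff)
      then have "g (e - f) \<in> g ` range i" using i(2) p(1) by auto
      then have "e - f \<in> range i" using assms(1) by (auto dest: bij_is_inj injD)
      then have "p (e - f) = 0" using p(1) by auto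
      then show "x = y" using ef by (simp add: diff)
    qed
  qed
  show "bij \<beta>"
  proof (rule bijI)
    show "inj \<beta>"
      by (rule injI) (metis assms(1) bij_is_inj i(1,3) injD)
    have "\<exists>a. b = \<beta> a" for b
    proof -
      have "i b \<in> g ` range i" using i(2) by blast
      then show ?thesis using i(1,3) by (metis (no_types) imageE injD)
    qed
    then show "surj \<beta>" by (simp add: surj_def)
  qed
qed

text \<open>Forward substitution: the \<open>p\<close>-coordinate of a preimage is found by
  inverting \<open>\<alpha>\<close>; it fixes the correction \<open>\<phi> x\<close>, after which
  \<open>\<beta>\<close> is inverted to find the \<open>q\<close>-coordinate.\<close>

lemma bij_triangular:
  fixes \<phi> :: "'x \<Rightarrow> 'y::ab_group_add"
  assumes inj: "\<And>e f. p e = p f \<Longrightarrow> q e = q f \<Longrightarrow> e = f" and ex: "\<And>x a. \<exists>e. p e = x \<and> q e = a"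
    and g: "\<And>e. p (g e) = \<alpha> (p e)" "\<And>e. q (g e) = \<phi> (p e) + \<beta> (q e)"
    and "bij \<alpha>" "bij \<beta>"
  shows "bij g"
proof (rule bijI)
  show "inj g"
  proof (rule injI)
    fix e f assume "g e = g f"
    then have "\<alpha> (p e) = \<alpha> (p f)" "\<phi> (p e) + \<beta> (q e) = \<phi> (p f) + \<beta> (q f)" by (metis g)+
    then show "e = f" using bij_is_inj[OF assms(5)] bij_is_inj[OF assms(6)] by (auto intro!: inj simp: inj_eq)
  qed
  show "surj g"
  unfolding surj_def
  proof
    fix f
    obtain x where x: "\<alpha> x = p f" using \<open>bij \<alpha>\<close> by (metis bij_pointE)
    obtain a where a: "\<beta> a = q f - \<phi> x" using \<open>bij \<beta>\<close> by (metis bij_pointE)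
    obtain e where "p e = x" "q e = a" using ex by blast
    then have "g e = f" by (intro inj) (simp_all add: g x a)
    then show "\<exists>e. f = g e" by blast
  qed
qed

section \<open>A fixed abelian extension with a linear section, computed in coordinates\<close>

locale rrb_extension =
  fixes A :: "('k::field, 'a::ab_group_add, 'v::ab_group_add) rrb"
    and B :: "('k, 'b::ab_group_add, 'm::ab_group_add) rrb"
    and E :: "('k, 'e::ab_group_add, 'w::ab_group_add) rrb"
    and iA :: "'b \<Rightarrow> 'e" and iV :: "'m \<Rightarrow> 'w"
    and pA :: "'e \<Rightarrow> 'a" and pV :: "'w \<Rightarrow> 'v"
    and sA :: "'a \<Rightarrow> 'e" and sV :: "'v \<Rightarrow> 'w"
  assumes ext: "abelian_extension A B E iA iV pA pV"
    and sec: "linear_section A E pA pV sA sV"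
begin

abbreviation "rB \<equiv> ext_\<rho>B E iA sA"
abbreviation "rM \<equiv> ext_\<rho>M E iV sA"
abbreviation "mu \<equiv> ext_\<mu> E iA iV sV"
abbreviation "\<omega> \<equiv> ext_\<omega> A E iA sA"
abbreviation "varpi \<equiv> ext_varpi A E iV sA sV"
abbreviation "\<chi> \<equiv> ext_\<chi> A E iA sA sV"

lemma rrb: "rrb_lie_algebra A" "rrb_lie_algebra B" "rrb_lie_algebra E"
  and hom: "(iA, iV) \<in> rrb_hom B E" "(pA, pV) \<in> rrb_hom E A"
  and inj_iA: "inj iA" and inj_iV: "inj iV" and surj_pA: "surj pA" and surj_pV: "surj pV"
  and range_iA: "range iA = {e. pA e = 0}" and range_iV: "range iV = {w. pV w = 0}"
  using ext by (auto simp: abelian_extension_def)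

lemma abelian [simp]: "brk B a b = 0" "act B a m = 0"
  using ext by (auto simp: abelian_extension_def rrb_abelian_def)

lemma section_lin: "Vector_Spaces.linear (scaleA A) (scaleA E) sA"
    "Vector_Spaces.linear (scaleV A) (scaleV E) sV"
  and p_s [simp]: "pA (sA x) = x" "pV (sV v) = v"
  using sec by (auto simp: linear_section_def)

lemmas vs = rrb[THEN rrb_lie_algebraD(1)] rrb[THEN rrb_lie_algebraD(2)]

lemmas hom_lin = hom[THEN rrb_homD(1)] hom[THEN rrb_homD(2)]

lemmas lin_simps [simp] =
  hom_lin[THEN linear_mapD(1)] hom_lin[THEN linear_mapD(2)] hom_lin[THEN linear_mapD(3)]
  hom_lin[THEN linear_mapD(4)] hom_lin[THEN linear_mapD(5)]
  section_lin[THEN linear_mapD(1)] section_lin[THEN linear_mapD(2)] section_lin[THEN linear_mapD(3)]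
  section_lin[THEN linear_mapD(4)] section_lin[THEN linear_mapD(5)]
  vs[THEN scale_simps(1)] vs[THEN scale_simps(2)] vs[THEN scale_simps(3)] vs[THEN scale_simps(4)]

lemmas brk_simps [simp] =
  rrb[THEN rrb_lie_algebraD(3), THEN bilinear_mapD(1)]
  rrb[THEN rrb_lie_algebraD(3), THEN bilinear_mapD(2)]
  rrb[THEN rrb_lie_algebraD(3), THEN bilinear_mapD(3)]
  rrb[THEN rrb_lie_algebraD(3), THEN bilinear_mapD(4)]
  rrb[THEN rrb_lie_algebraD(3), THEN bilinear_mapD(5)]
  rrb[THEN rrb_lie_algebraD(3), THEN bilinear_mapD(6)]
  rrb[THEN rrb_lie_algebraD(3), THEN bilinear_mapD(7)]
  rrb[THEN rrb_lie_algebraD(3), THEN bilinear_mapD(8)]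
  rrb[THEN rrb_lie_algebraD(3), THEN bilinear_mapD(9)]
  rrb[THEN rrb_lie_algebraD(3), THEN bilinear_mapD(10)]
  rrb[THEN rrb_lie_algebraD(6)]

lemmas act_simps [simp] =
  rrb[THEN rrb_lie_algebraD(4), THEN bilinear_mapD(1)]
  rrb[THEN rrb_lie_algebraD(4), THEN bilinear_mapD(2)]
  rrb[THEN rrb_lie_algebraD(4), THEN bilinear_mapD(3)]
  rrb[THEN rrb_lie_algebraD(4), THEN bilinear_mapD(4)]
  rrb[THEN rrb_lie_algebraD(4), THEN bilinear_mapD(5)]
  rrb[THEN rrb_lie_algebraD(4), THEN bilinear_mapD(6)]
  rrb[THEN rrb_lie_algebraD(4), THEN bilinear_mapD(7)]
  rrb[THEN rrb_lie_algebraD(4), THEN bilinear_mapD(8)]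
  rrb[THEN rrb_lie_algebraD(4), THEN bilinear_mapD(9)]
  rrb[THEN rrb_lie_algebraD(4), THEN bilinear_mapD(10)]

lemmas oper_simps [simp] =
  rrb[THEN rrb_lie_algebraD(5), THEN linear_mapD(1)]
  rrb[THEN rrb_lie_algebraD(5), THEN linear_mapD(2)]
  rrb[THEN rrb_lie_algebraD(5), THEN linear_mapD(3)]
  rrb[THEN rrb_lie_algebraD(5), THEN linear_mapD(4)]
  rrb[THEN rrb_lie_algebraD(5), THEN linear_mapD(5)]

lemmas p_hom [simp] = rrb_homD(3-5)[OF hom(2)]

lemma i_hom [simp]:
  "brk E (iA a) (iA b) = 0" "oper E (iV m) = iA (oper B m)" "act E (iA a) (iV m) = 0"
  using rrb_homD(3-5)[OF hom(1), symmetric] by simp_all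

lemma p_i [simp]: "pA (iA a) = 0" "pV (iV m) = 0"
  using range_iA range_iV by auto

text \<open>Together with \<open>pA\<close> and \<open>pV\<close> these coordinates identify \<open>E\<close> with \<open>A \<oplus> B\<close> and \<open>V \<oplus> M\<close>.\<close>

definition qA :: "'e \<Rightarrow> 'b" where "qA e = inv_into UNIV iA (e - sA (pA e))"
definition qV :: "'w \<Rightarrow> 'm" where "qV w = inv_into UNIV iV (w - sV (pV w))"

text \<open>The difference \<open>e - sA (pA e)\<close> is killed by \<open>pA\<close>, so by
  exactness it lies in \<open>range iA\<close>, where \<open>inv_into\<close> is a genuine
  inverse.\<close>

lemma i_q: "iA (qA e) = e - sA (pA e)" "iV (qV w) = w - sV (pV w)"
  unfolding qA_def qV_def by (intro f_inv_into_f; simp add: range_iA range_iV)+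

lemma decomp: "e = sA (pA e) + iA (qA e)" "w = sV (pV w) + iV (qV w)"
  by (simp_all add: i_q)

lemma coord_eqI:
  "pA e = pA f \<Longrightarrow> qA e = qA f \<Longrightarrow> e = f" "pV w = pV z \<Longrightarrow> qV w = qV z \<Longrightarrow> w = z"
  by (metis decomp(1)) (metis decomp(2))

lemma qA_eqI: "iA a = e - sA (pA e) \<Longrightarrow> qA e = a"
  using i_q(1)[of e] inj_iA by (metis injD)

lemma qV_eqI: "iV a = e - sV (pV e) \<Longrightarrow> qV e = a"
  using i_q(2)[of e] inj_iV by (metis injD)

lemma q_lin: "Vector_Spaces.linear (scaleA E) (scaleA B) qA"
    "Vector_Spaces.linear (scaleV E) (scaleV B) qV"
  by (intro linear_mapI vs qA_eqI qV_eqI; simp add: i_q)+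

lemmas q_simps [simp] =
  q_lin[THEN linear_mapD(1)] q_lin[THEN linear_mapD(2)] q_lin[THEN linear_mapD(3)]
  q_lin[THEN linear_mapD(4)] q_lin[THEN linear_mapD(5)]

lemma q_s_i [simp]: "qA (sA x) = 0" "qV (sV v) = 0" "qA (iA a) = a" "qV (iV m) = m"
  by (intro qA_eqI qV_eqI; simp)+

text \<open>On the kernel the section term vanishes, so the inverse of \<open>iA\<close> can be
  replaced by the globally linear projection \<open>qA\<close>.\<close>

lemma inv_iA: "pA e = 0 \<Longrightarrow> inv_into UNIV iA e = qA e"
  by (simp add: qA_def)

lemma inv_iV: "pV w = 0 \<Longrightarrow> inv_into UNIV iV w = qV w"
  by (simp add: qV_def)

text \<open>The terms subtracted in the definitions lie in the image of the section, which
  \<open>qA\<close> and \<open>qV\<close> annihilate.\<close>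

lemma structure_maps:
  "rB x a = qA (brk E (sA x) (iA a))" "rM x m = qV (act E (sA x) (iV m))"
  "mu v a = - qV (act E (iA a) (sV v))" "\<omega> x y = qA (brk E (sA x) (sA y))"
  "varpi x v = qV (act E (sA x) (sV v))" "\<chi> v = qA (oper E (sV v))"
  by (simp_all add: ext_\<rho>B_def ext_\<rho>M_def ext_\<mu>_def ext_\<omega>_def ext_varpi_def ext_\<chi>_def inv_iA inv_iV)

lemma bilin: "bilinear_map (scaleA A) (scaleA B) (scaleA B) rB"
    "bilinear_map (scaleA A) (scaleV B) (scaleV B) rM"
    "bilinear_map (scaleV A) (scaleA B) (scaleV B) mu"
    "bilinear_map (scaleA A) (scaleA A) (scaleA B) \<omega>"
    "bilinear_map (scaleA A) (scaleV A) (scaleV B) varpi"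
    "Vector_Spaces.linear (scaleV A) (scaleA B) \<chi>"
  by (intro bilinear_mapI linear_mapI vs; simp add: structure_maps)+

lemmas bilin_simps [simp] =
  bilin(1-5)[THEN bilinear_mapD(1)] bilin(1-5)[THEN bilinear_mapD(2)]
  bilin(1-5)[THEN bilinear_mapD(3)] bilin(1-5)[THEN bilinear_mapD(4)]
  bilin(1-5)[THEN bilinear_mapD(5)] bilin(1-5)[THEN bilinear_mapD(6)]
  bilin(1-5)[THEN bilinear_mapD(7)] bilin(1-5)[THEN bilinear_mapD(8)]
  bilin(1-5)[THEN bilinear_mapD(9)] bilin(1-5)[THEN bilinear_mapD(10)]
  linear_mapD(1-5)[OF bilin(6)]

lemma \<omega>_alt [simp]: "\<omega> x x = 0"
  by (simp add: structure_maps)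

text \<open>Expand both arguments along the splitting. The part in \<open>B\<close> times
  \<open>B\<close> vanishes because \<open>B\<close> is abelian, and antisymmetry turns the part in
  \<open>B\<close> times \<open>A\<close> into \<open>rB\<close> with a minus sign.\<close>

lemma q_brk [simp]:
  "qA (brk E e f) = \<omega> (pA e) (pA f) + rB (pA e) (qA f) - rB (pA f) (qA e)"
proof -
  have "qA (brk E e f) = qA (brk E (sA (pA e) + iA (qA e)) (sA (pA f) + iA (qA f)))"
    using decomp by simp
  also have "\<dots> = \<omega> (pA e) (pA f) + rB (pA e) (qA f) + qA (brk E (iA (qA e)) (sA (pA f)))"
    by (simp add: structure_maps)
  also have "brk E (iA (qA e)) (sA (pA f)) = - brk E (sA (pA f)) (iA (qA e))"
    by (rule rrb_lie_algebraD(7)[OF rrb(3)])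
  finally show ?thesis by (simp add: structure_maps)
qed

text \<open>As for the bracket, except that the minus sign of the last term is built into the
  definition of \<open>mu\<close>.\<close>

lemma q_act [simp]:
  "qV (act E e w) = varpi (pA e) (pV w) + rM (pA e) (qV w) - mu (pV w) (qA e)"
proof -
  have "qV (act E e w) = qV (act E (sA (pA e) + iA (qA e)) (sV (pV w) + iV (qV w)))"
    using decomp by simp
  also have "\<dots> = varpi (pA e) (pV w) + rM (pA e) (qV w) - mu (pV w) (qA e)"
    by (simp add: structure_maps)
  finally show ?thesis .
qed

lemma q_oper [simp]: "qA (oper E w) = \<chi> (pV w) + oper B (qV w)"
proof -
  have "qA (oper E w) = qA (oper E (sV (pV w) + iV (qV w)))" using decomp by simp
  also have "\<dots> = \<chi> (pV w) + oper B (qV w)" by (simp add: structure_maps)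
  finally show ?thesis .
qed

text \<open>These make \<open>(rB, rM, mu)\<close> a representation on \<open>oper B\<close>. They
  are the axioms of \<open>E\<close> in the \<open>q\<close>-coordinate with exactly one argument
  from \<open>B\<close> or \<open>M\<close>, which eliminates the cocycle terms.\<close>

lemma rep_simps:
  "rB (brk A x y) a = rB x (rB y a) - rB y (rB x a)"
  "rM (brk A x y) m = rM x (rM y m) - rM y (rM x m)"
  "mu (act A x v) a = rM x (mu v a) - mu v (rB x a)"
  "rB (oper A v) (oper B m) = oper B (rM (oper A v) m + mu v (oper B m))"
  using arg_cong[OF rrb_lie_algebraD(8)[OF rrb(3), of "sA x" "sA y" "iA a"], of qA]
    arg_cong[OF rrb_lie_algebraD(9)[OF rrb(3), of "sA x" "sA y" "iV m"], of qV]
    arg_cong[OF rrb_lie_algebraD(9)[OF rrb(3), of "sA x" "iA a" "sV v"], of qV]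
    arg_cong[OF rrb_lie_algebraD(10)[OF rrb(3), of "sV v" "iV m"], of qA]
  by (simp_all add: algebra_simps)

text \<open>The axioms of \<open>E\<close> in the \<open>q\<close>-coordinate again, now with all
  arguments taken from the section: Jacobi, the representation law and the Rota-Baxter identity give
  the three conditions.\<close>

lemma cocycle: "(\<omega>, varpi, \<chi>) \<in> carrier (Z2 A B rB rM mu)"
proof -
  have "rB x (\<omega> y z) - rB y (\<omega> x z) + rB z (\<omega> x y)
      - \<omega> (brk A x y) z + \<omega> (brk A x z) y - \<omega> (brk A y z) x = 0" for x y z
  proof -
    \<comment> \<open>Jacobi is cyclic while the cocycle condition orders its arguments;
      antisymmetry of \<omega> and of the bracket of \<open>A\<close> reconciles them.\<close>
    have alt: "\<omega> u v = - \<omega> v u" for u v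
      unfolding structure_maps by (subst rrb_lie_algebraD(7)[OF rrb(3)]) simp
    show ?thesis
      using arg_cong[OF rrb_lie_algebraD(8)[OF rrb(3), of "sA x" "sA y" "sA z"], of qA]
        alt[of "brk A x y" z] alt[of "brk A y z" x] alt[of "brk A x z" y] alt[of x z]
        rrb_lie_algebraD(7)[OF rrb(1), of z x]
      by (simp add: algebra_simps)
  qed
  moreover have "- varpi (brk A x y) v + mu v (\<omega> x y) + rM x (varpi y v) - rM y (varpi x v)
          - varpi y (act A x v) + varpi x (act A y v) = 0" for x y v
    using arg_cong[OF rrb_lie_algebraD(9)[OF rrb(3), of "sA x" "sA y" "sV v"], of qV]
    by (simp add: algebra_simps)
  moreover have "rB (oper A v1) (\<chi> v2) - rB (oper A v2) (\<chi> v1)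
          - oper B (mu v1 (\<chi> v2) - mu v2 (\<chi> v1))
          - \<chi> (act A (oper A v1) v2 - act A (oper A v2) v1)
          + \<omega> (oper A v1) (oper A v2)
          - oper B (varpi (oper A v1) v2 - varpi (oper A v2) v1) = 0" for v1 v2
    using arg_cong[OF rrb_lie_algebraD(10)[OF rrb(3), of "sV v1" "sV v2"], of qA]
    by (simp add: algebra_simps)
  ultimately show ?thesis
    unfolding Z2_def using bilin by auto
qed

subsection \<open>The cochain complex\<close>

text \<open>The Chevalley-Eilenberg differential of a 2-cochain with values in \<open>B\<close>.
  Naming the three components allows additivity and equivariance to be stated as identities, apart
  from their vanishing.\<close>

definition d1 where "d1 fB x y z = rB x (fB y z) - rB y (fB x z) + rB z (fB x y)
  - fB (brk A x y) z + fB (brk A x z) y - fB (brk A y z) x"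

definition d2 where "d2 fB fM x y v = - fM (brk A x y) v + mu v (fB x y) + rM x (fM y v)
  - rM y (fM x v) - fM y (act A x v) + fM x (act A y v)"

definition d3 where "d3 fB fM \<theta> v1 v2 = rB (oper A v1) (\<theta> v2) - rB (oper A v2) (\<theta> v1)
  - oper B (mu v1 (\<theta> v2) - mu v2 (\<theta> v1))
  - \<theta> (act A (oper A v1) v2 - act A (oper A v2) v1)
  + fB (oper A v1) (oper A v2)
  - oper B (fM (oper A v1) v2 - fM (oper A v2) v1)"

definition cochain2 where "cochain2 fB fM \<theta> \<longleftrightarrow>
  bilinear_map (scaleA A) (scaleA A) (scaleA B) fB \<and> (\<forall>x. fB x x = 0) \<and>
  bilinear_map (scaleA A) (scaleV A) (scaleV B) fM \<and>
  Vector_Spaces.linear (scaleV A) (scaleA B) \<theta>"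

lemma mem_Z2: "(fB, fM, \<theta>) \<in> carrier (Z2 A B rB rM mu) \<longleftrightarrow> cochain2 fB fM \<theta> \<and>
  (\<forall>x y z. d1 fB x y z = 0) \<and> (\<forall>x y v. d2 fB fM x y v = 0) \<and> (\<forall>u v. d3 fB fM \<theta> u v = 0)"
  by (simp add: Z2_def d1_def d2_def d3_def cochain2_def)

lemma Z2_simps [simp]:
  "(fB, fM, \<theta>) \<otimes>\<^bsub>Z2 A B rB rM mu\<^esub> (gB, gM, \<eta>) =
    (\<lambda>x y. fB x y + gB x y, \<lambda>x v. fM x v + gM x v, \<lambda>v. \<theta> v + \<eta> v)"
  "\<one>\<^bsub>Z2 A B rB rM mu\<^esub> = (\<lambda>x y. 0, \<lambda>x v. 0, \<lambda>v. 0)"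
  by (simp_all add: Z2_def)

lemma cochain2_add:
  assumes "cochain2 fB fM \<theta>" "cochain2 gB gM \<eta>"
  shows "cochain2 (\<lambda>x y. fB x y + gB x y) (\<lambda>x v. fM x v + gM x v) (\<lambda>v. \<theta> v + \<eta> v)"
  using assms unfolding cochain2_def
  by (auto intro!: bilinear_mapI linear_mapI vs simp: bilinear_mapD linear_mapD)

lemma cochain2_minus:
  assumes "cochain2 fB fM \<theta>"
  shows "cochain2 (\<lambda>x y. - fB x y) (\<lambda>x v. - fM x v) (\<lambda>v. - \<theta> v)"
  using assms unfolding cochain2_def
  by (auto intro!: bilinear_mapI linear_mapI vs simp: bilinear_mapD linear_mapD)

lemma d_add:
  "d1 (\<lambda>x y. fB x y + gB x y) x y z = d1 fB x y z + d1 gB x y z"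
  "d2 (\<lambda>x y. fB x y + gB x y) (\<lambda>x v. fM x v + gM x v) x y v = d2 fB fM x y v + d2 gB gM x y v"
  "d3 (\<lambda>x y. fB x y + gB x y) (\<lambda>x v. fM x v + gM x v) (\<lambda>v. \<theta> v + \<eta> v) v1 v2 =
    d3 fB fM \<theta> v1 v2 + d3 gB gM \<eta> v1 v2"
  by (simp_all add: d1_def d2_def d3_def algebra_simps)

lemma d_minus:
  "d1 (\<lambda>x y. - fB x y) x y z = - d1 fB x y z"
  "d2 (\<lambda>x y. - fB x y) (\<lambda>x v. - fM x v) x y v = - d2 fB fM x y v"
  "d3 (\<lambda>x y. - fB x y) (\<lambda>x v. - fM x v) (\<lambda>v. - \<theta> v) v1 v2 = - d3 fB fM \<theta> v1 v2"
  by (simp_all add: d1_def d2_def d3_def algebra_simps)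

lemma Z2_add: "x \<in> carrier (Z2 A B rB rM mu) \<Longrightarrow> y \<in> carrier (Z2 A B rB rM mu) \<Longrightarrow>
    x \<otimes>\<^bsub>Z2 A B rB rM mu\<^esub> y \<in> carrier (Z2 A B rB rM mu)"
  by (cases x; cases y) (simp add: mem_Z2 d_add cochain2_add)

lemma Z2_minus: "(fB, fM, \<theta>) \<in> carrier (Z2 A B rB rM mu) \<Longrightarrow>
    (\<lambda>x y. - fB x y, \<lambda>x v. - fM x v, \<lambda>v. - \<theta> v) \<in> carrier (Z2 A B rB rM mu)"
  by (simp add: mem_Z2 d_minus cochain2_minus)

lemma comm_group_Z2: "comm_group (Z2 A B rB rM mu)"
proof (rule comm_groupI)
  show "\<one>\<^bsub>Z2 A B rB rM mu\<^esub> \<in> carrier (Z2 A B rB rM mu)"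
    by (auto simp: mem_Z2 d1_def d2_def d3_def cochain2_def intro!: bilinear_mapI linear_mapI vs)
  show "\<exists>y\<in>carrier (Z2 A B rB rM mu). y \<otimes>\<^bsub>Z2 A B rB rM mu\<^esub> x = \<one>\<^bsub>Z2 A B rB rM mu\<^esub>"
    if "x \<in> carrier (Z2 A B rB rM mu)" for x
    using that by (cases x) (auto intro!: bexI[OF _ Z2_minus])
qed (auto simp: Z2_add ac_simps)

lemma inv_Z2:
  assumes "(fB, fM, \<theta>) \<in> carrier (Z2 A B rB rM mu)"
  shows "inv\<^bsub>Z2 A B rB rM mu\<^esub> (fB, fM, \<theta>) = (\<lambda>x y. - fB x y, \<lambda>x v. - fM x v, \<lambda>v. - \<theta> v)"
  using assms Z2_minus[OF assms]
  by (intro group.inv_equality[OF comm_group.axioms(2)[OF comm_group_Z2]]) auto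

text \<open>The differential on 1-cochains: \<open>B2\<close> is its image and \<open>Z1\<close> its
  kernel.\<close>

definition cobound where "cobound \<phi>B \<phi>M =
  (\<lambda>x y. rB x (\<phi>B y) - rB y (\<phi>B x) - \<phi>B (brk A x y),
   \<lambda>x v. - mu v (\<phi>B x) + rM x (\<phi>M v) - \<phi>M (act A x v),
   \<lambda>v. - \<phi>B (oper A v) + oper B (\<phi>M v))"

lemma cobound_add:
  "cobound f g \<otimes>\<^bsub>Z2 A B rB rM mu\<^esub> cobound f' g' = cobound (\<lambda>x. f x + f' x) (\<lambda>v. g v + g' v)"
  by (simp add: cobound_def fun_eq_iff algebra_simps)

lemma cobound_minus:
  "cobound (\<lambda>x. - f x) (\<lambda>v. - g v) =
    (case cobound f g of (a, b, c) \<Rightarrow> (\<lambda>x y. - a x y, \<lambda>x v. - b x v, \<lambda>v. - c v))"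
  by (simp add: cobound_def fun_eq_iff algebra_simps)

definition cochain1 where "cochain1 \<phi>B \<phi>M \<longleftrightarrow>
  Vector_Spaces.linear (scaleA A) (scaleA B) \<phi>B \<and> Vector_Spaces.linear (scaleV A) (scaleV B) \<phi>M"

lemma B2_eq: "B2 A B rB rM mu = {cobound \<phi>B \<phi>M | \<phi>B \<phi>M. cochain1 \<phi>B \<phi>M}"
  by (simp add: B2_def cobound_def cochain1_def)

lemma cochain1_simps:
  assumes "cochain1 f g"
  shows "f 0 = 0" "f (x + y) = f x + f y" "f (- x) = - f x" "f (x - y) = f x - f y"
    "f (scaleA A c x) = scaleA B c (f x)"
    "g 0 = 0" "g (v + w) = g v + g w" "g (- v) = - g v" "g (v - w) = g v - g w"
    "g (scaleV A c v) = scaleV B c (g v)"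
  using assms by (auto simp: cochain1_def linear_mapD)

lemma cochain1_zero: "cochain1 (\<lambda>x. 0) (\<lambda>v. 0)"
  unfolding cochain1_def by (auto intro!: linear_mapI vs)

lemma cochain1_add:
  assumes "cochain1 f g" "cochain1 f' g'"
  shows "cochain1 (\<lambda>x. f x + f' x) (\<lambda>v. g v + g' v)"
  unfolding cochain1_def
  by (auto intro!: linear_mapI vs simp: cochain1_simps[OF assms(1)] cochain1_simps[OF assms(2)])

lemma cochain1_minus:
  assumes "cochain1 f g"
  shows "cochain1 (\<lambda>x. - f x) (\<lambda>v. - g v)"
  unfolding cochain1_def by (auto intro!: linear_mapI vs simp: cochain1_simps[OF assms(1)])

lemma cochain1_comp:
  assumes "cochain1 f g" "(\<alpha>1, \<alpha>2) \<in> rrb_hom A A"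
  shows "cochain1 (f \<circ> \<alpha>1) (g \<circ> \<alpha>2)"
  using assms(1) rrb_homD(1,2)[OF assms(2)]
  by (auto simp: cochain1_def intro: Vector_Spaces.linear_compose)

text \<open>The differential squares to zero: \<open>rep_simps\<close> cancels the terms with two
  actions, and the axioms of \<open>A\<close> cancel those in which \<open>f\<close> or
  \<open>g\<close> is applied to nested operations.\<close>

lemma cobound_Z2:
  assumes "cochain1 f g"
  shows "cobound f g \<in> carrier (Z2 A B rB rM mu)"
proof -
  \<comment> \<open>Up to antisymmetry this is \<open>f\<close> applied to the Jacobi identity of
    \<open>A\<close>.\<close>
  have j: "f (brk A (brk A x y) z) - f (brk A (brk A x z) y) + f (brk A (brk A y z) x) = 0"
    for x y z
    using arg_cong[OF rrb_lie_algebraD(8)[OF rrb(1), of x y z], of f]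
      rrb_lie_algebraD(7)[OF rrb(1), of "brk A x y" z] rrb_lie_algebraD(7)[OF rrb(1), of "brk A y z" x]
      rrb_lie_algebraD(7)[OF rrb(1), of "brk A x z" y] rrb_lie_algebraD(7)[OF rrb(1), of z x]
    by (simp add: cochain1_simps[OF assms] algebra_simps)
  show ?thesis
    using j unfolding cobound_def mem_Z2 cochain2_def d1_def d2_def d3_def
    by (intro conjI allI bilinear_mapI linear_mapI vs)
      (auto simp: cochain1_simps[OF assms] rep_simps rrb_lie_algebraD(9,10)[OF rrb(1)] algebra_simps)
qed

lemma subgroup_B2: "subgroup (B2 A B rB rM mu) (Z2 A B rB rM mu)"
proof (rule group.subgroupI[OF comm_group.axioms(2)[OF comm_group_Z2]])
  show "B2 A B rB rM mu \<subseteq> carrier (Z2 A B rB rM mu)"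
    using cobound_Z2 by (auto simp: B2_eq)
  show "B2 A B rB rM mu \<noteq> {}"
    unfolding B2_eq using cochain1_zero by blast
next
  fix x assume "x \<in> B2 A B rB rM mu"
  then obtain f g where fg: "x = cobound f g" "cochain1 f g" by (auto simp: B2_eq)
  have "inv\<^bsub>Z2 A B rB rM mu\<^esub> cobound f g = cobound (\<lambda>x. - f x) (\<lambda>v. - g v)"
    using cobound_Z2[OF fg(2)] inv_Z2 by (auto simp: cobound_minus split: prod.split)
  then show "inv\<^bsub>Z2 A B rB rM mu\<^esub> x \<in> B2 A B rB rM mu"
    unfolding B2_eq fg(1) using cochain1_minus[OF fg(2)] by blast
next
  fix x y assume "x \<in> B2 A B rB rM mu" "y \<in> B2 A B rB rM mu"
  then obtain f g f' g' where fg: "x = cobound f g" "cochain1 f g" "y = cobound f' g'" "cochain1 f' g'"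
    by (auto simp: B2_eq)
  have "x \<otimes>\<^bsub>Z2 A B rB rM mu\<^esub> y = cobound (\<lambda>x. f x + f' x) (\<lambda>v. g v + g' v)"
    unfolding fg by (rule cobound_add)
  then show "x \<otimes>\<^bsub>Z2 A B rB rM mu\<^esub> y \<in> B2 A B rB rM mu"
    unfolding B2_eq using cochain1_add[OF fg(2,4)] by blast
qed

lemma mem_Z1: "(f, g) \<in> carrier (Z1 A B rB rM mu) \<longleftrightarrow> cochain1 f g \<and>
    cobound f g = (\<lambda>x y. 0, \<lambda>x v. 0, \<lambda>v. 0)"
  by (auto simp: Z1_def cochain1_def cobound_def fun_eq_iff algebra_simps)

lemma Z1_simps [simp]:
  "(f, g) \<otimes>\<^bsub>Z1 A B rB rM mu\<^esub> (f', g') = (\<lambda>x. f x + f' x, \<lambda>v. g v + g' v)"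
  "\<one>\<^bsub>Z1 A B rB rM mu\<^esub> = (\<lambda>x. 0, \<lambda>v. 0)"
  by (simp_all add: Z1_def)

lemma group_Z1: "group (Z1 A B rB rM mu)"
proof (rule groupI)
  show "\<one>\<^bsub>Z1 A B rB rM mu\<^esub> \<in> carrier (Z1 A B rB rM mu)"
    by (simp add: mem_Z1 cochain1_zero) (simp add: cobound_def)
  show "x \<otimes>\<^bsub>Z1 A B rB rM mu\<^esub> y \<in> carrier (Z1 A B rB rM mu)"
    if "x \<in> carrier (Z1 A B rB rM mu)" "y \<in> carrier (Z1 A B rB rM mu)" for x y
    using that
    by (cases x; cases y) (simp add: mem_Z1 cochain1_add flip: cobound_add)
  show "\<exists>y\<in>carrier (Z1 A B rB rM mu). y \<otimes>\<^bsub>Z1 A B rB rM mu\<^esub> x = \<one>\<^bsub>Z1 A B rB rM mu\<^esub>"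
    if "x \<in> carrier (Z1 A B rB rM mu)" for x
  proof (cases x)
    case (Pair f g)
    then have "(\<lambda>x. - f x, \<lambda>v. - g v) \<in> carrier (Z1 A B rB rM mu)"
      using that by (simp add: mem_Z1 cochain1_minus cobound_minus)
    then show ?thesis using Pair by (intro bexI) auto
  qed
qed (auto simp: add.assoc)

subsection \<open>Automorphisms of the extension\<close>

lemma mem_Aut_ext: "(\<gamma>1, \<gamma>2) \<in> carrier (Aut_ext E iA iV) \<longleftrightarrow> (\<gamma>1, \<gamma>2) \<in> rrb_hom E E \<and>
    bij \<gamma>1 \<and> bij \<gamma>2 \<and> \<gamma>1 ` range iA = range iA \<and> \<gamma>2 ` range iV = range iV"
  by (auto simp: Aut_ext_def mem_rrb_Aut)

lemma Aut_ext_simps [simp]: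
  "(f, g) \<otimes>\<^bsub>Aut_ext E iA iV\<^esub> (f', g') = (f \<circ> f', g \<circ> g')" "\<one>\<^bsub>Aut_ext E iA iV\<^esub> = (id, id)"
  by (simp_all add: Aut_ext_def rrb_Aut_def)

lemma group_Aut_ext: "group (Aut_ext E iA iV)"
  unfolding Aut_ext_def
proof (rule subgroup.subgroup_is_group[OF _ group_rrb_Aut[OF rrb(3)]],
    rule group.subgroupI[OF group_rrb_Aut[OF rrb(3)]])
  let ?H = "{(\<gamma>1, \<gamma>2) \<in> carrier (rrb_Aut E). \<gamma>1 ` range iA = range iA \<and> \<gamma>2 ` range iV = range iV}"
  show "?H \<subseteq> carrier (rrb_Aut E)" by auto
  have "(id, id) \<in> ?H"
    using monoid.one_closed[OF group.is_monoid[OF group_rrb_Aut[OF rrb(3)]]] by simp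
  then show "?H \<noteq> {}" by blast
  show "inv\<^bsub>rrb_Aut E\<^esub> x \<in> ?H" if "x \<in> ?H" for x
    using that rrb_Aut_inv
    by (cases x) (auto simp: inv_rrb_Aut[OF rrb(3)] mem_rrb_Aut image_inv_eq)
  show "x \<otimes>\<^bsub>rrb_Aut E\<^esub> y \<in> ?H" if "x \<in> ?H" "y \<in> ?H" for x y
  proof -
    obtain f g f' g' where xy: "x = (f, g)" "y = (f', g')" by (metis surj_pair)
    have "(f \<circ> f') ` range iA = range iA" "(g \<circ> g') ` range iV = range iV"
      using that unfolding xy by (intro image_comp_eq; simp)+
    moreover have "(f \<circ> f', g \<circ> g') \<in> carrier (rrb_Aut E)"
      using that monoid.m_closed[OF group.is_monoid[OF group_rrb_Aut[OF rrb(3)]], of x y]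
      by (auto simp: xy)
    ultimately show ?thesis by (simp add: xy)
  qed
qed

lemma mem_compatible: "((\<alpha>1, \<alpha>2), (\<beta>1, \<beta>2)) \<in> carrier (compatible_pairs A B rB rM mu) \<longleftrightarrow>
    (\<alpha>1, \<alpha>2) \<in> rrb_hom A A \<and> bij \<alpha>1 \<and> bij \<alpha>2 \<and> (\<beta>1, \<beta>2) \<in> rrb_hom B B \<and> bij \<beta>1 \<and> bij \<beta>2 \<and>
    (\<forall>x a. \<beta>1 (rB x a) = rB (\<alpha>1 x) (\<beta>1 a)) \<and> (\<forall>x m. \<beta>2 (rM x m) = rM (\<alpha>1 x) (\<beta>2 m)) \<and>
    (\<forall>v a. \<beta>2 (mu v a) = mu (\<alpha>2 v) (\<beta>1 a))"
  by (auto simp: compatible_pairs_def DirProd_def mem_rrb_Aut)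

lemma compatible_simps [simp]:
  "((f, g), (h, k)) \<otimes>\<^bsub>compatible_pairs A B rB rM mu\<^esub> ((f', g'), (h', k')) =
    ((f \<circ> f', g \<circ> g'), (h \<circ> h', k \<circ> k'))"
  "\<one>\<^bsub>compatible_pairs A B rB rM mu\<^esub> = ((id, id), (id, id))"
  by (simp_all add: compatible_pairs_def DirProd_def rrb_Aut_def)

text \<open>Applying \<beta> to both sides reduces compatibility of the inverses to that of the
  given pair at preimages.\<close>

lemma compatible_inv:
  assumes "((\<alpha>1, \<alpha>2), (\<beta>1, \<beta>2)) \<in> carrier (compatible_pairs A B rB rM mu)"
  shows "((inv_into UNIV \<alpha>1, inv_into UNIV \<alpha>2), (inv_into UNIV \<beta>1, inv_into UNIV \<beta>2))
    \<in> carrier (compatible_pairs A B rB rM mu)"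
proof -
  note c = assms[unfolded mem_compatible]
  have [simp]: "\<alpha>1 (inv_into UNIV \<alpha>1 x) = x" "\<alpha>2 (inv_into UNIV \<alpha>2 v) = v"
    "\<beta>1 (inv_into UNIV \<beta>1 a) = a" "\<beta>2 (inv_into UNIV \<beta>2 m) = m" for x v a m
    using c by (simp_all add: bij_def surj_f_inv_f)
  have *: "inv_into UNIV \<beta>1 b = a" if "b = \<beta>1 a" for a b
    using that c by (simp add: bij_def)
  have **: "inv_into UNIV \<beta>2 m = n" if "m = \<beta>2 n" for m n
    using that c by (simp add: bij_def)
  have "inv_into UNIV \<beta>1 (rB x a) = rB (inv_into UNIV \<alpha>1 x) (inv_into UNIV \<beta>1 a)"
    "inv_into UNIV \<beta>2 (rM x m) = rM (inv_into UNIV \<alpha>1 x) (inv_into UNIV \<beta>2 m)"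
    "inv_into UNIV \<beta>2 (mu v a) = mu (inv_into UNIV \<alpha>2 v) (inv_into UNIV \<beta>1 a)" for x a m v
    by (rule * **; simp add: c)+
  then show ?thesis
    using c rrb_Aut_inv[of \<alpha>1 \<alpha>2 A] rrb_Aut_inv[of \<beta>1 \<beta>2 B]
    by (simp add: mem_compatible mem_rrb_Aut)
qed

lemma group_compatible: "group (compatible_pairs A B rB rM mu)"
proof (rule groupI)
  show "\<one>\<^bsub>compatible_pairs A B rB rM mu\<^esub> \<in> carrier (compatible_pairs A B rB rM mu)"
    using vs by (simp add: mem_compatible rrb_hom_def linear_map_id)
  show "x \<otimes>\<^bsub>compatible_pairs A B rB rM mu\<^esub> y \<in> carrier (compatible_pairs A B rB rM mu)"
    if "x \<in> carrier (compatible_pairs A B rB rM mu)" "y \<in> carrier (compatible_pairs A B rB rM mu)"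
    for x y
  proof -
    obtain f g h k f' g' h' k' where "x = ((f, g), (h, k))" "y = ((f', g'), (h', k'))"
      by (metis surj_pair)
    then show ?thesis using that by (auto simp: mem_compatible intro: rrb_hom_comp bij_comp)
  qed
  show "\<exists>y\<in>carrier (compatible_pairs A B rB rM mu).
      y \<otimes>\<^bsub>compatible_pairs A B rB rM mu\<^esub> x = \<one>\<^bsub>compatible_pairs A B rB rM mu\<^esub>"
    if "x \<in> carrier (compatible_pairs A B rB rM mu)" for x
  proof -
    obtain f g h k where "x = ((f, g), (h, k))" by (metis surj_pair)
    then show ?thesis
      using that compatible_inv[of f g h k]
      by (intro bexI[of _ "((inv_into UNIV f, inv_into UNIV g), (inv_into UNIV h, inv_into UNIV k))"])
        (auto simp: mem_compatible bij_def)
  qed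
qed (auto simp: compatible_pairs_def DirProd_def rrb_Aut_def comp_assoc)

text \<open>The matrix with diagonal \<alpha>, \<beta> and lower left entry \<phi>, acting on the
  coordinates \<open>(pA, qA)\<close>.\<close>

definition triA where "triA \<alpha> \<beta> \<phi> e = sA (\<alpha> (pA e)) + iA (\<phi> (pA e) + \<beta> (qA e))"
definition triV where "triV \<alpha> \<beta> \<phi> w = sV (\<alpha> (pV w)) + iV (\<phi> (pV w) + \<beta> (qV w))"

lemma tri_coords [simp]:
  "pA (triA \<alpha> \<beta> \<phi> e) = \<alpha> (pA e)" "qA (triA \<alpha> \<beta> \<phi> e) = \<phi> (pA e) + \<beta> (qA e)"
  "pV (triV \<alpha>' \<beta>' \<phi>' w) = \<alpha>' (pV w)" "qV (triV \<alpha>' \<beta>' \<phi>' w) = \<phi>' (pV w) + \<beta>' (qV w)"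
  by (simp_all add: triA_def triV_def)

text \<open>The equations of \<open>liftable\<close> are the off-diagonal coordinates of the homomorphism conditions for
  the triangular maps.\<close>

definition liftable where "liftable \<alpha>1 \<alpha>2 \<beta>1 \<beta>2 \<phi>B \<phi>M \<longleftrightarrow> cochain1 \<phi>B \<phi>M \<and>
  (\<forall>x y. \<phi>B (brk A x y) =
    \<omega> (\<alpha>1 x) (\<alpha>1 y) - \<beta>1 (\<omega> x y) + rB (\<alpha>1 x) (\<phi>B y) - rB (\<alpha>1 y) (\<phi>B x)) \<and>
  (\<forall>x v. \<phi>M (act A x v) =
    varpi (\<alpha>1 x) (\<alpha>2 v) - \<beta>2 (varpi x v) + rM (\<alpha>1 x) (\<phi>M v) - mu (\<alpha>2 v) (\<phi>B x)) \<and>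
  (\<forall>v. \<phi>B (oper A v) = \<chi> (\<alpha>2 v) - \<beta>1 (\<chi> v) + oper B (\<phi>M v))"

text \<open>Each homomorphism condition is compared in coordinates. The \<open>p\<close>-parts hold
  because \<alpha> is a homomorphism; the \<open>q\<close>-parts split into compatibility of the
  diagonal and the equations of \<open>liftable\<close>.\<close>

lemma tri_Aut_ext:
  assumes "((\<alpha>1, \<alpha>2), (\<beta>1, \<beta>2)) \<in> carrier (compatible_pairs A B rB rM mu)"
    and l: "liftable \<alpha>1 \<alpha>2 \<beta>1 \<beta>2 \<phi>B \<phi>M"
  shows "(triA \<alpha>1 \<beta>1 \<phi>B, triV \<alpha>2 \<beta>2 \<phi>M) \<in> carrier (Aut_ext E iA iV)"
proof -
  note c = assms(1)[unfolded mem_compatible]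
  have \<alpha>: "(\<alpha>1, \<alpha>2) \<in> rrb_hom A A" and \<beta>: "(\<beta>1, \<beta>2) \<in> rrb_hom B B" using c by auto
  have \<phi>: "cochain1 \<phi>B \<phi>M" using l by (simp add: liftable_def)
  note [simp] = cochain1_simps[OF \<phi>] linear_mapD(1-5)[OF rrb_homD(1)[OF \<alpha>]]
    linear_mapD(1-5)[OF rrb_homD(2)[OF \<alpha>]] linear_mapD(1-5)[OF rrb_homD(1)[OF \<beta>]]
    linear_mapD(1-5)[OF rrb_homD(2)[OF \<beta>]] rrb_homD(3-5)[OF \<alpha>] rrb_homD(4)[OF \<beta>]
  have "Vector_Spaces.linear (scaleA E) (scaleA E) (triA \<alpha>1 \<beta>1 \<phi>B)"
    "Vector_Spaces.linear (scaleV E) (scaleV E) (triV \<alpha>2 \<beta>2 \<phi>M)"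
    by (auto intro!: linear_mapI vs coord_eqI simp: algebra_simps)
  moreover have "triA \<alpha>1 \<beta>1 \<phi>B (brk E e f) = brk E (triA \<alpha>1 \<beta>1 \<phi>B e) (triA \<alpha>1 \<beta>1 \<phi>B f)" for e f
    using l c by (intro coord_eqI) (simp_all add: liftable_def algebra_simps)
  moreover have "oper E (triV \<alpha>2 \<beta>2 \<phi>M w) = triA \<alpha>1 \<beta>1 \<phi>B (oper E w)" for w
    using l c by (intro coord_eqI) (simp_all add: liftable_def algebra_simps)
  moreover have "triV \<alpha>2 \<beta>2 \<phi>M (act E e w) = act E (triA \<alpha>1 \<beta>1 \<phi>B e) (triV \<alpha>2 \<beta>2 \<phi>M w)" for e w
    using l c by (intro coord_eqI) (simp_all add: liftable_def algebra_simps)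
  ultimately have "(triA \<alpha>1 \<beta>1 \<phi>B, triV \<alpha>2 \<beta>2 \<phi>M) \<in> rrb_hom E E"
    by (simp add: rrb_hom_def)
  \<comment> \<open>The element with coordinates \<open>x\<close> and \<open>a\<close> is
    \<open>sA x + iA a\<close>.\<close>
  moreover have "bij (triA \<alpha>1 \<beta>1 \<phi>B)"
    by (rule bij_triangular[of pA qA _ \<alpha>1 \<phi>B \<beta>1, OF coord_eqI(1)])
      (use c in \<open>auto intro: exI[of _ "sA _ + iA _"]\<close>)
  moreover have "bij (triV \<alpha>2 \<beta>2 \<phi>M)"
    by (rule bij_triangular[of pV qV _ \<alpha>2 \<phi>M \<beta>2, OF coord_eqI(2)])
      (use c in \<open>auto intro: exI[of _ "sV _ + iV _"]\<close>)
  \<comment> \<open>Since \<beta> is surjective, this gives equality of ranges and not just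
    inclusion.\<close>
  moreover have "triA \<alpha>1 \<beta>1 \<phi>B \<circ> iA = iA \<circ> \<beta>1" "triV \<alpha>2 \<beta>2 \<phi>M \<circ> iV = iV \<circ> \<beta>2"
    by (auto simp: triA_def triV_def)
  then have "triA \<alpha>1 \<beta>1 \<phi>B ` range iA = range iA" "triV \<alpha>2 \<beta>2 \<phi>M ` range iV = range iV"
    using c by (metis bij_is_surj image_comp)+
  ultimately show ?thesis by (simp add: mem_Aut_ext)
qed

text \<open>Linearity of \<phi> and \<alpha> is needed at 0: on \<open>range iA\<close> and
  \<open>range iV\<close> the matrix must reduce to \<beta>.\<close>

lemma K_tri:
  assumes "((\<alpha>1, \<alpha>2), (\<beta>1, \<beta>2)) \<in> carrier (compatible_pairs A B rB rM mu)"
    and "cochain1 \<phi>B \<phi>M"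
  shows "K_map iA iV pA pV sA sV (triA \<alpha>1 \<beta>1 \<phi>B, triV \<alpha>2 \<beta>2 \<phi>M) = ((\<alpha>1, \<alpha>2), (\<beta>1, \<beta>2))"
proof -
  have \<alpha>: "(\<alpha>1, \<alpha>2) \<in> rrb_hom A A" using assms(1) by (simp add: mem_compatible)
  show ?thesis
    by (auto simp: K_map_def fun_eq_iff inv_iA inv_iV cochain1_simps[OF assms(2)]
        linear_mapD[OF rrb_homD(1)[OF \<alpha>]] linear_mapD[OF rrb_homD(2)[OF \<alpha>]])
qed

lemma Aut_ext_kernel:
  assumes "(\<gamma>1, \<gamma>2) \<in> carrier (Aut_ext E iA iV)"
  shows "pA (\<gamma>1 (iA a)) = 0" "pV (\<gamma>2 (iV m)) = 0"
  using assms range_iA range_iV by (auto simp: mem_Aut_ext)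

text \<open>Converse to \<open>tri_Aut_ext\<close>: invariance of \<open>B\<close> and
  \<open>M\<close> makes the upper right entry zero. The homomorphism law on section elements gives
  \<open>liftable\<close> and that \<alpha> is a homomorphism; on a section element paired with one
  of \<open>B\<close> or \<open>M\<close> it gives compatibility.\<close>

lemma Aut_ext_triangular:
  assumes \<gamma>: "(\<gamma>1, \<gamma>2) \<in> carrier (Aut_ext E iA iV)"
  defines "\<alpha>1 \<equiv> pA \<circ> \<gamma>1 \<circ> sA" and "\<alpha>2 \<equiv> pV \<circ> \<gamma>2 \<circ> sV"
    and "\<beta>1 \<equiv> inv_into UNIV iA \<circ> \<gamma>1 \<circ> iA" and "\<beta>2 \<equiv> inv_into UNIV iV \<circ> \<gamma>2 \<circ> iV"
    and "\<phi>B \<equiv> qA \<circ> \<gamma>1 \<circ> sA" and "\<phi>M \<equiv> qV \<circ> \<gamma>2 \<circ> sV"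
  shows "((\<alpha>1, \<alpha>2), (\<beta>1, \<beta>2)) \<in> carrier (compatible_pairs A B rB rM mu)"
    "liftable \<alpha>1 \<alpha>2 \<beta>1 \<beta>2 \<phi>B \<phi>M" "\<gamma>1 = triA \<alpha>1 \<beta>1 \<phi>B" "\<gamma>2 = triV \<alpha>2 \<beta>2 \<phi>M"
proof -
  note k [simp] = Aut_ext_kernel[OF \<gamma>]
  have h: "(\<gamma>1, \<gamma>2) \<in> rrb_hom E E" using \<gamma> by (simp add: mem_Aut_ext)
  note [simp] = linear_mapD(1-5)[OF rrb_homD(1)[OF h]] linear_mapD(1-5)[OF rrb_homD(2)[OF h]]
  have \<beta>: "\<beta>1 a = qA (\<gamma>1 (iA a))" "\<beta>2 m = qV (\<gamma>2 (iV m))" for a m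
    by (simp_all add: \<beta>1_def \<beta>2_def inv_iA inv_iV)
  have \<alpha>\<phi>: "\<alpha>1 x = pA (\<gamma>1 (sA x))" "\<alpha>2 v = pV (\<gamma>2 (sV v))"
    "\<phi>B x = qA (\<gamma>1 (sA x))" "\<phi>M v = qV (\<gamma>2 (sV v))" for x v
    by (simp_all add: \<alpha>1_def \<alpha>2_def \<phi>B_def \<phi>M_def)
  have "\<gamma>1 e = \<gamma>1 (sA (pA e)) + \<gamma>1 (iA (qA e))" "\<gamma>2 w = \<gamma>2 (sV (pV w)) + \<gamma>2 (iV (qV w))" for e w
    using linear_mapD(2)[OF rrb_homD(1)[OF h]] linear_mapD(2)[OF rrb_homD(2)[OF h]] decomp by metis+
  then have co: "pA (\<gamma>1 e) = \<alpha>1 (pA e)" "qA (\<gamma>1 e) = \<phi>B (pA e) + \<beta>1 (qA e)"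
    "pV (\<gamma>2 w) = \<alpha>2 (pV w)" "qV (\<gamma>2 w) = \<phi>M (pV w) + \<beta>2 (qV w)" for e w
    by (metis (no_types) \<alpha>\<phi> \<beta> k lin_simps q_simps add_0_right)+
  show g: "\<gamma>1 = triA \<alpha>1 \<beta>1 \<phi>B" "\<gamma>2 = triV \<alpha>2 \<beta>2 \<phi>M"
    by (auto intro!: coord_eqI simp: co)
  have lin: "Vector_Spaces.linear (scaleA A) (scaleA A) \<alpha>1" "Vector_Spaces.linear (scaleV A) (scaleV A) \<alpha>2"
    "Vector_Spaces.linear (scaleA B) (scaleA B) \<beta>1" "Vector_Spaces.linear (scaleV B) (scaleV B) \<beta>2"
    "Vector_Spaces.linear (scaleA A) (scaleA B) \<phi>B" "Vector_Spaces.linear (scaleV A) (scaleV B) \<phi>M"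
    by (intro linear_mapI vs; simp add: \<alpha>\<phi> \<beta>)+
  note [simp] = lin[THEN linear_mapD(1)] co
  show "liftable \<alpha>1 \<alpha>2 \<beta>1 \<beta>2 \<phi>B \<phi>M"
    unfolding liftable_def cochain1_def
  proof (intro conjI allI)
    show "\<phi>B (brk A x y) =
        \<omega> (\<alpha>1 x) (\<alpha>1 y) - \<beta>1 (\<omega> x y) + rB (\<alpha>1 x) (\<phi>B y) - rB (\<alpha>1 y) (\<phi>B x)" for x y
      using arg_cong[OF rrb_homD(3)[OF h, of "sA x" "sA y"], of qA] by (simp add: algebra_simps)
    show "\<phi>M (act A x v) =
        varpi (\<alpha>1 x) (\<alpha>2 v) - \<beta>2 (varpi x v) + rM (\<alpha>1 x) (\<phi>M v) - mu (\<alpha>2 v) (\<phi>B x)" for x v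
      using arg_cong[OF rrb_homD(5)[OF h, of "sA x" "sV v"], of qV] by (simp add: algebra_simps)
    show "\<phi>B (oper A v) = \<chi> (\<alpha>2 v) - \<beta>1 (\<chi> v) + oper B (\<phi>M v)" for v
      using arg_cong[OF rrb_homD(4)[OF h, of "sV v"], of qA] by (simp add: algebra_simps)
  qed (fact lin)+
  have "\<alpha>1 (brk A x y) = brk A (\<alpha>1 x) (\<alpha>1 y)" "\<alpha>1 (oper A v) = oper A (\<alpha>2 v)"
    "\<alpha>2 (act A x v) = act A (\<alpha>1 x) (\<alpha>2 v)" for x y v
    using arg_cong[OF rrb_homD(3)[OF h, of "sA x" "sA y"], of pA]
      arg_cong[OF rrb_homD(4)[OF h, of "sV v"], of pA]
      arg_cong[OF rrb_homD(5)[OF h, of "sA x" "sV v"], of pV] by simp_all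
  then have \<alpha>_hom: "(\<alpha>1, \<alpha>2) \<in> rrb_hom A A"
    using lin by (simp add: rrb_hom_def)
  have "\<beta>1 (oper B m) = oper B (\<beta>2 m)" for m
    using arg_cong[OF rrb_homD(4)[OF h, of "iV m"], of qA] by simp
  then have \<beta>_hom: "(\<beta>1, \<beta>2) \<in> rrb_hom B B"
    using lin by (simp add: rrb_hom_def)
  have i\<beta>: "iA (\<beta>1 a) = \<gamma>1 (iA a)" "iV (\<beta>2 m) = \<gamma>2 (iV m)" for a m
    \<comment> \<open>With \<open>co\<close> active, \<open>qA (\<gamma>1 (iA a))\<close> would be
      turned back into \<open>\<beta>1 a\<close> before \<open>i_q\<close> could apply.\<close>
    by (simp_all add: \<beta> i_q del: co)
  have "\<beta>1 (rB x a) = rB (\<alpha>1 x) (\<beta>1 a)" for x a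
    using arg_cong[OF rrb_homD(3)[OF h, of "sA x" "iA a"], of qA] by simp
  moreover have "\<beta>2 (rM x m) = rM (\<alpha>1 x) (\<beta>2 m)" for x m
    using arg_cong[OF rrb_homD(5)[OF h, of "sA x" "iV m"], of qV] by simp
  moreover have "\<beta>2 (mu v a) = mu (\<alpha>2 v) (\<beta>1 a)" for v a
    using arg_cong[OF rrb_homD(5)[OF h, of "iA a" "sV v"], of qV]
    by (simp add: linear_mapD(3)[OF lin(4)])
  moreover have "bij \<alpha>1" "bij \<beta>1"
    using \<gamma> unfolding mem_Aut_ext
    by (blast intro: bij_diagonal[of \<gamma>1 iA \<beta>1 pA \<alpha>1, OF _ inj_iA _ i\<beta>(1) range_iA surj_pA co(1)]
      linear_mapD(4)[OF rrb_homD(1)[OF h]] lin_simps)+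
  moreover have "bij \<alpha>2" "bij \<beta>2"
    using \<gamma> unfolding mem_Aut_ext
    by (blast intro: bij_diagonal[of \<gamma>2 iV \<beta>2 pV \<alpha>2, OF _ inj_iV _ i\<beta>(2) range_iV surj_pV co(3)]
      linear_mapD(4)[OF rrb_homD(2)[OF h]] lin_simps)+
  ultimately show "((\<alpha>1, \<alpha>2), (\<beta>1, \<beta>2)) \<in> carrier (compatible_pairs A B rB rM mu)"
    using \<alpha>_hom \<beta>_hom by (simp add: mem_compatible)
qed

subsection \<open>Exactness\<close>

abbreviation "K \<equiv> K_map iA iV pA pV sA sV"
abbreviation "\<iota> \<equiv> \<iota>_map iA iV pA pV sA sV"
abbreviation "W \<equiv> Wells_map A B rB rM mu \<omega> varpi \<chi>"

definition obstruction where "obstruction \<alpha>1 \<alpha>2 \<beta>1 \<beta>2 =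
  (\<lambda>x y. \<beta>1 (\<omega> (inv_into UNIV \<alpha>1 x) (inv_into UNIV \<alpha>1 y)) - \<omega> x y,
   \<lambda>x v. \<beta>2 (varpi (inv_into UNIV \<alpha>1 x) (inv_into UNIV \<alpha>2 v)) - varpi x v,
   \<lambda>v. \<beta>1 (\<chi> (inv_into UNIV \<alpha>2 v)) - \<chi> v)"

text \<open>As \<alpha> is bijective, the equations may be tested at arguments
  \<open>\<alpha>1 x\<close> and \<open>\<alpha>2 v\<close>. This removes the inverses and leaves
  the equations of \<open>liftable\<close> with off-diagonal entry \<open>f\<close> composed with
  \<alpha>.\<close>

lemma obstruction_cobound:
  assumes c: "((\<alpha>1, \<alpha>2), (\<beta>1, \<beta>2)) \<in> carrier (compatible_pairs A B rB rM mu)"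
    and "cochain1 f g"
  shows "obstruction \<alpha>1 \<alpha>2 \<beta>1 \<beta>2 = cobound f g \<longleftrightarrow> liftable \<alpha>1 \<alpha>2 \<beta>1 \<beta>2 (f \<circ> \<alpha>1) (g \<circ> \<alpha>2)"
proof -
  have h: "(\<alpha>1, \<alpha>2) \<in> rrb_hom A A" and "bij \<alpha>1" "bij \<alpha>2"
    using c by (auto simp: mem_compatible)
  then have [simp]: "inv_into UNIV \<alpha>1 (\<alpha>1 x) = x" "inv_into UNIV \<alpha>2 (\<alpha>2 v) = v" for x v
    by (simp_all add: bij_def)
  have all: "(\<forall>x. P x) \<longleftrightarrow> (\<forall>x. P (\<alpha>1 x))" "(\<forall>v. Q v) \<longleftrightarrow> (\<forall>v. Q (\<alpha>2 v))" for P Q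
    using \<open>bij \<alpha>1\<close> \<open>bij \<alpha>2\<close> by (metis bij_pointE)+
  have "cochain1 (f \<circ> \<alpha>1) (g \<circ> \<alpha>2)"
    using assms(2) h by (rule cochain1_comp)
  moreover have "obstruction \<alpha>1 \<alpha>2 \<beta>1 \<beta>2 = cobound f g \<longleftrightarrow>
    (\<forall>x y. \<beta>1 (\<omega> x y) - \<omega> (\<alpha>1 x) (\<alpha>1 y) =
      rB (\<alpha>1 x) (f (\<alpha>1 y)) - rB (\<alpha>1 y) (f (\<alpha>1 x)) - f (\<alpha>1 (brk A x y))) \<and>
    (\<forall>x v. \<beta>2 (varpi x v) - varpi (\<alpha>1 x) (\<alpha>2 v) =
      rM (\<alpha>1 x) (g (\<alpha>2 v)) - mu (\<alpha>2 v) (f (\<alpha>1 x)) - g (\<alpha>2 (act A x v))) \<and>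
    (\<forall>v. \<beta>1 (\<chi> v) - \<chi> (\<alpha>2 v) = - f (\<alpha>1 (oper A v)) + oper B (g (\<alpha>2 v)))"
    unfolding obstruction_def cobound_def prod.inject fun_eq_iff
    \<comment> \<open>Only the obstruction side is reindexed: three quantifiers over
      \<open>A\<close> and two over \<open>V\<close>.\<close>
    by (subst (1 2 3) all(1), subst (1 2) all(2)) (simp add: rrb_homD(3-5)[OF h])
  ultimately show ?thesis
    unfolding liftable_def comp_apply group_eq_rearrange by blast
qed

lemma K_Aut_ext: "\<gamma> \<in> carrier (Aut_ext E iA iV) \<Longrightarrow> K \<gamma> \<in> carrier (compatible_pairs A B rB rM mu)"
  using Aut_ext_triangular(1) by (cases \<gamma>) (simp add: K_map_def)

lemma K_hom: "K \<in> hom (Aut_ext E iA iV) (compatible_pairs A B rB rM mu)"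
proof (rule homI)
  fix \<gamma> \<delta> assume mem: "\<gamma> \<in> carrier (Aut_ext E iA iV)" "\<delta> \<in> carrier (Aut_ext E iA iV)"
  obtain \<gamma>1 \<gamma>2 \<delta>1 \<delta>2 where eq: "\<gamma> = (\<gamma>1, \<gamma>2)" "\<delta> = (\<delta>1, \<delta>2)" by (metis surj_pair)
  have "pA (\<gamma>1 e) = pA (\<gamma>1 (sA (pA e)))" "pV (\<gamma>2 w) = pV (\<gamma>2 (sV (pV w)))" for e w
    using arg_cong[OF fun_cong[OF Aut_ext_triangular(3)], of \<gamma>1 \<gamma>2 pA e]
      arg_cong[OF fun_cong[OF Aut_ext_triangular(4)], of \<gamma>1 \<gamma>2 pV w] mem eq by simp_all
  \<comment> \<open>Likewise on the kernels, where \<delta> stays inside the range and the inverse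
    cancels.\<close>
  moreover have "iA (qA (\<delta>1 (iA a))) = \<delta>1 (iA a)" "iV (qV (\<delta>2 (iV m))) = \<delta>2 (iV m)" for a m
    using Aut_ext_kernel[of \<delta>1 \<delta>2] mem eq by (simp_all add: i_q)
  ultimately show "K (\<gamma> \<otimes>\<^bsub>Aut_ext E iA iV\<^esub> \<delta>) = K \<gamma> \<otimes>\<^bsub>compatible_pairs A B rB rM mu\<^esub> K \<delta>"
    using Aut_ext_kernel[of \<gamma>1 \<gamma>2] Aut_ext_kernel[of \<delta>1 \<delta>2] mem
    by (simp add: K_map_def eq fun_eq_iff inv_iA inv_iV)
qed (rule K_Aut_ext)

text \<open>With identity diagonal, composing matrices adds their off-diagonal entries; hence
  \<iota> turns sums into compositions.\<close>

lemma \<iota>_eq: "\<iota> (f, g) = (triA id id f, triV id id g)"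
  by (auto simp: \<iota>_map_def triA_def triV_def fun_eq_iff i_q)

lemma id_compatible: "((id, id), (id, id)) \<in> carrier (compatible_pairs A B rB rM mu)"
  using monoid.one_closed[OF group.is_monoid[OF group_compatible]] by simp

text \<open>For the identity diagonal the obstruction is zero, so liftability means that the
  coboundary vanishes.\<close>

lemma Z1_liftable: "(f, g) \<in> carrier (Z1 A B rB rM mu) \<longleftrightarrow> liftable id id id id f g"
proof -
  have "obstruction id id id id = (\<lambda>x y. 0, \<lambda>x v. 0, \<lambda>v. 0)"
    by (simp add: obstruction_def)
  then show ?thesis
    using obstruction_cobound[OF id_compatible, of f g] by (auto simp: mem_Z1 liftable_def)
qed

lemma \<iota>_hom: "\<iota> \<in> hom (Z1 A B rB rM mu) (Aut_ext E iA iV)"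
proof (rule homI)
  show "\<iota> \<phi> \<in> carrier (Aut_ext E iA iV)" if "\<phi> \<in> carrier (Z1 A B rB rM mu)" for \<phi>
    using that tri_Aut_ext[OF id_compatible] by (cases \<phi>) (simp add: \<iota>_eq Z1_liftable)
  show "\<iota> (\<phi> \<otimes>\<^bsub>Z1 A B rB rM mu\<^esub> \<psi>) = \<iota> \<phi> \<otimes>\<^bsub>Aut_ext E iA iV\<^esub> \<iota> \<psi>" for \<phi> \<psi>
    by (cases \<phi>; cases \<psi>) (auto simp: \<iota>_eq fun_eq_iff algebra_simps intro!: coord_eqI)
qed

lemma inj_\<iota>: "inj \<iota>"
proof (rule injI)
  fix \<phi> \<psi> :: "('a \<Rightarrow> 'b) \<times> ('v \<Rightarrow> 'm)"
  assume eq: "\<iota> \<phi> = \<iota> \<psi>"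
  obtain f g f' g' where fg: "\<phi> = (f, g)" "\<psi> = (f', g')" by (metis surj_pair)
  \<comment> \<open>Evaluation on the section recovers the off-diagonal entries; no cocycle
    condition enters.\<close>
  have "qA (triA id id f (sA x)) = qA (triA id id f' (sA x))"
    "qV (triV id id g (sV v)) = qV (triV id id g' (sV v))" for x v
    using eq by (simp_all add: fg \<iota>_eq del: tri_coords)
  then show "\<phi> = \<psi>" by (auto simp: fg)
qed

lemma image_\<iota>: "\<iota> ` carrier (Z1 A B rB rM mu) =
    kernel (Aut_ext E iA iV) (compatible_pairs A B rB rM mu) K"
proof (intro equalityI subsetI)
  fix \<gamma> assume "\<gamma> \<in> \<iota> ` carrier (Z1 A B rB rM mu)"
  then obtain f g where "(f, g) \<in> carrier (Z1 A B rB rM mu)" "\<gamma> = \<iota> (f, g)" by auto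
  then show "\<gamma> \<in> kernel (Aut_ext E iA iV) (compatible_pairs A B rB rM mu) K"
    using tri_Aut_ext[OF id_compatible] K_tri[OF id_compatible]
    by (simp add: kernel_def \<iota>_eq Z1_liftable liftable_def)
next
  fix \<gamma> assume \<gamma>: "\<gamma> \<in> kernel (Aut_ext E iA iV) (compatible_pairs A B rB rM mu) K"
  obtain \<gamma>1 \<gamma>2 where eq: "\<gamma> = (\<gamma>1, \<gamma>2)" by (metis surj_pair)
  have mem: "(\<gamma>1, \<gamma>2) \<in> carrier (Aut_ext E iA iV)" and "K \<gamma> = ((id, id), (id, id))"
    using \<gamma> by (auto simp: kernel_def eq)
  then show "\<gamma> \<in> \<iota> ` carrier (Z1 A B rB rM mu)"
    using Aut_ext_triangular(2-4)[OF mem]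
    \<comment> \<open>The preimage is the off-diagonal part of \<gamma>, whose diagonal is the
      identity by assumption.\<close>
    by (intro image_eqI[of _ _ "(qA \<circ> \<gamma>1 \<circ> sA, qV \<circ> \<gamma>2 \<circ> sV)"])
      (simp_all add: K_map_def eq \<iota>_eq Z1_liftable)
qed

section \<open>The Wells class and exactness at the compatible pairs\<close>

definition transport where "transport \<alpha>1 \<alpha>2 \<beta>1 \<beta>2 fB fM \<theta> =
  (\<lambda>x y. \<beta>1 (fB (inv_into UNIV \<alpha>1 x) (inv_into UNIV \<alpha>1 y)),
   \<lambda>x v. \<beta>2 (fM (inv_into UNIV \<alpha>1 x) (inv_into UNIV \<alpha>2 v)),
   \<lambda>v. \<beta>1 (\<theta> (inv_into UNIV \<alpha>2 v)))"

text \<open>The differentials are equivariant: on a transported cochain each equals \<beta> applied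
  to the original differential at the preimages under \<alpha>.\<close>

lemma transport_Z2:
  assumes C: "((\<alpha>1, \<alpha>2), (\<beta>1, \<beta>2)) \<in> carrier (compatible_pairs A B rB rM mu)"
    and f: "(fB, fM, \<theta>) \<in> carrier (Z2 A B rB rM mu)"
  shows "transport \<alpha>1 \<alpha>2 \<beta>1 \<beta>2 fB fM \<theta> \<in> carrier (Z2 A B rB rM mu)"
proof -
  define a1 where "a1 = inv_into UNIV \<alpha>1"
  define a2 where "a2 = inv_into UNIV \<alpha>2"
  note c = C[unfolded mem_compatible]
  have \<alpha>: "(a1, a2) \<in> rrb_hom A A"
    using compatible_inv[OF C] by (simp add: mem_compatible a1_def a2_def)
  have \<beta>: "(\<beta>1, \<beta>2) \<in> rrb_hom B B" using c by simp
  have inv: "\<alpha>1 (a1 x) = x" "\<alpha>2 (a2 v) = v" for x v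
    using c by (simp_all add: a1_def a2_def bij_def surj_f_inv_f)
  \<comment> \<open>Compatibility at preimages, oriented to pull \<beta> out of the action
    maps.\<close>
  have eqv: "rB x (\<beta>1 a) = \<beta>1 (rB (a1 x) a)" "rM x (\<beta>2 m) = \<beta>2 (rM (a1 x) m)"
    "mu v (\<beta>1 a) = \<beta>2 (mu (a2 v) a)" for x v a m
    using c by (simp_all add: inv)
  note [simp] = linear_mapD(1-5)[OF rrb_homD(1)[OF \<alpha>]]
    linear_mapD(1-5)[OF rrb_homD(2)[OF \<alpha>]] linear_mapD(1-5)[OF rrb_homD(1)[OF \<beta>]]
    linear_mapD(1-5)[OF rrb_homD(2)[OF \<beta>]]
  note homs = rrb_homD(3-5)[OF \<alpha>] rrb_homD(4)[OF \<beta>, symmetric]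
  have "cochain2 fB fM \<theta>" and d: "\<And>x y z. d1 fB x y z = 0" "\<And>x y v. d2 fB fM x y v = 0"
    "\<And>u v. d3 fB fM \<theta> u v = 0"
    using f by (simp_all add: mem_Z2)
  then have fl: "bilinear_map (scaleA A) (scaleA A) (scaleA B) fB" "\<And>x. fB x x = 0"
    "bilinear_map (scaleA A) (scaleV A) (scaleV B) fM"
    "Vector_Spaces.linear (scaleV A) (scaleA B) \<theta>"
    by (simp_all add: cochain2_def)
  have "cochain2 (\<lambda>x y. \<beta>1 (fB (a1 x) (a1 y))) (\<lambda>x v. \<beta>2 (fM (a1 x) (a2 v))) (\<lambda>v. \<beta>1 (\<theta> (a2 v)))"
    unfolding cochain2_def
    by (intro conjI allI bilinear_mapI linear_mapI vs)
      (simp_all add: fl bilinear_mapD[OF fl(1)] bilinear_mapD[OF fl(3)] linear_mapD[OF fl(4)])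
  moreover have "d1 (\<lambda>x y. \<beta>1 (fB (a1 x) (a1 y))) x y z = \<beta>1 (d1 fB (a1 x) (a1 y) (a1 z))" for x y z
    by (simp add: d1_def eqv homs)
  moreover have "d2 (\<lambda>x y. \<beta>1 (fB (a1 x) (a1 y))) (\<lambda>x v. \<beta>2 (fM (a1 x) (a2 v))) x y v =
      \<beta>2 (d2 fB fM (a1 x) (a1 y) (a2 v))" for x y v
    by (simp add: d2_def eqv homs)
  moreover have "d3 (\<lambda>x y. \<beta>1 (fB (a1 x) (a1 y))) (\<lambda>x v. \<beta>2 (fM (a1 x) (a2 v)))
      (\<lambda>v. \<beta>1 (\<theta> (a2 v))) u v = \<beta>1 (d3 fB fM \<theta> (a2 u) (a2 v))" for u v
    by (simp add: d3_def eqv homs)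
  ultimately show ?thesis
    by (simp add: transport_def mem_Z2 d flip: a1_def a2_def)
qed

lemma W_eq: "W ((\<alpha>1, \<alpha>2), (\<beta>1, \<beta>2)) =
    B2 A B rB rM mu #>\<^bsub>Z2 A B rB rM mu\<^esub> obstruction \<alpha>1 \<alpha>2 \<beta>1 \<beta>2"
  by (simp add: Wells_map_def obstruction_def)

text \<open>The obstruction is the transport of the cocycle of the extension minus that
  cocycle.\<close>

lemma obstruction_Z2:
  assumes "((\<alpha>1, \<alpha>2), (\<beta>1, \<beta>2)) \<in> carrier (compatible_pairs A B rB rM mu)"
  shows "obstruction \<alpha>1 \<alpha>2 \<beta>1 \<beta>2 \<in> carrier (Z2 A B rB rM mu)"
  using Z2_add[OF transport_Z2[OF assms cocycle] Z2_minus[OF cocycle]]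
  by (simp add: transport_def obstruction_def)

text \<open>The class is trivial iff the obstruction is some \<open>cobound f g\<close>. Composition
  with the bijective \<alpha> permutes the 1-cochains, so such a pair exists exactly when some
  off-diagonal entry is liftable.\<close>

lemma W_one_iff:
  assumes c: "((\<alpha>1, \<alpha>2), (\<beta>1, \<beta>2)) \<in> carrier (compatible_pairs A B rB rM mu)"
  shows "W ((\<alpha>1, \<alpha>2), (\<beta>1, \<beta>2)) = \<one>\<^bsub>H2 A B rB rM mu\<^esub> \<longleftrightarrow> (\<exists>f g. liftable \<alpha>1 \<alpha>2 \<beta>1 \<beta>2 f g)"
proof -
  have gr: "group (Z2 A B rB rM mu)" using comm_group.axioms(2)[OF comm_group_Z2] .
  have "W ((\<alpha>1, \<alpha>2), (\<beta>1, \<beta>2)) = \<one>\<^bsub>H2 A B rB rM mu\<^esub> \<longleftrightarrow>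
      obstruction \<alpha>1 \<alpha>2 \<beta>1 \<beta>2 \<in> B2 A B rB rM mu"
    using group.coset_join1[OF gr _ obstruction_Z2[OF c] subgroup_B2]
      group.coset_join2[OF gr obstruction_Z2[OF c] subgroup_B2]
    by (auto simp: W_eq H2_def FactGroup_def)
  also have "\<dots> \<longleftrightarrow> (\<exists>f g. cochain1 f g \<and> obstruction \<alpha>1 \<alpha>2 \<beta>1 \<beta>2 = cobound f g)"
    by (auto simp: B2_eq)
  also have "\<dots> \<longleftrightarrow> (\<exists>f g. cochain1 f g \<and> liftable \<alpha>1 \<alpha>2 \<beta>1 \<beta>2 (f \<circ> \<alpha>1) (g \<circ> \<alpha>2))"
    using obstruction_cobound[OF c] by auto
  also have "\<dots> \<longleftrightarrow> (\<exists>f g. liftable \<alpha>1 \<alpha>2 \<beta>1 \<beta>2 f g)"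
  proof (intro iffI; elim exE)
    fix f g assume l: "liftable \<alpha>1 \<alpha>2 \<beta>1 \<beta>2 f g"
    let ?f = "f \<circ> inv_into UNIV \<alpha>1" and ?g = "g \<circ> inv_into UNIV \<alpha>2"
    have "cochain1 f g" using l by (simp add: liftable_def)
    then have "cochain1 ?f ?g"
      using compatible_inv[OF c] by (auto simp: mem_compatible intro: cochain1_comp)
    moreover have "?f \<circ> \<alpha>1 = f" "?g \<circ> \<alpha>2 = g"
      using c by (auto simp: mem_compatible bij_def fun_eq_iff)
    ultimately show "\<exists>f g. cochain1 f g \<and> liftable \<alpha>1 \<alpha>2 \<beta>1 \<beta>2 (f \<circ> \<alpha>1) (g \<circ> \<alpha>2)"
      using l by metis
  qed blast
  finally show ?thesis .
qed

lemma W_H2: "W \<in> carrier (compatible_pairs A B rB rM mu) \<rightarrow> carrier (H2 A B rB rM mu)"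
proof
  fix c assume c: "c \<in> carrier (compatible_pairs A B rB rM mu)"
  obtain f g h k where eq: "c = ((f, g), (h, k))" by (metis surj_pair)
  show "W c \<in> carrier (H2 A B rB rM mu)"
    unfolding eq W_eq H2_def FactGroup_def partial_object.simps
    using obstruction_Z2 c eq
    by (auto intro!: group.rcosetsI[OF comm_group.axioms(2)[OF comm_group_Z2]
          subgroup.subset[OF subgroup_B2]])
qed

text \<open>The off-diagonal entry of an automorphism witnesses that its Wells class is trivial;
  conversely a liftable entry completes a given diagonal to a triangular preimage under
  \<open>K\<close>.\<close>

lemma image_K: "K ` carrier (Aut_ext E iA iV) =
    {c \<in> carrier (compatible_pairs A B rB rM mu). W c = \<one>\<^bsub>H2 A B rB rM mu\<^esub>}"
proof (intro equalityI subsetI)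
  fix c assume "c \<in> K ` carrier (Aut_ext E iA iV)"
  then obtain \<gamma>1 \<gamma>2 where mem: "(\<gamma>1, \<gamma>2) \<in> carrier (Aut_ext E iA iV)" and c: "c = K (\<gamma>1, \<gamma>2)"
    by auto
  show "c \<in> {c \<in> carrier (compatible_pairs A B rB rM mu). W c = \<one>\<^bsub>H2 A B rB rM mu\<^esub>}"
    using Aut_ext_triangular(1,2)[OF mem] W_one_iff[OF Aut_ext_triangular(1)[OF mem]]
    unfolding c K_map_def prod.case by blast
next
  fix c assume "c \<in> {c \<in> carrier (compatible_pairs A B rB rM mu). W c = \<one>\<^bsub>H2 A B rB rM mu\<^esub>}"
  then have c: "c \<in> carrier (compatible_pairs A B rB rM mu)" "W c = \<one>\<^bsub>H2 A B rB rM mu\<^esub>" by auto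
  obtain \<alpha>1 \<alpha>2 \<beta>1 \<beta>2 where eq: "c = ((\<alpha>1, \<alpha>2), (\<beta>1, \<beta>2))" by (metis surj_pair)
  obtain f g where "liftable \<alpha>1 \<alpha>2 \<beta>1 \<beta>2 f g" using W_one_iff c eq by blast
  then have "(triA \<alpha>1 \<beta>1 f, triV \<alpha>2 \<beta>2 g) \<in> carrier (Aut_ext E iA iV)"
    "K (triA \<alpha>1 \<beta>1 f, triV \<alpha>2 \<beta>2 g) = c"
    using tri_Aut_ext K_tri c eq by (auto simp: liftable_def)
  then show "c \<in> K ` carrier (Aut_ext E iA iV)" by (metis image_eqI)
qed

lemma normal_B2: "B2 A B rB rM mu \<lhd> Z2 A B rB rM mu"
  by (simp add: comm_group.normal_iff_subgroup[OF comm_group_Z2] subgroup_B2)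

end

theorem theorem5p4:
  fixes A :: "('k::field, 'a::ab_group_add, 'v::ab_group_add) rrb"
    and B :: "('k, 'b::ab_group_add, 'm::ab_group_add) rrb"
    and E :: "('k, 'e::ab_group_add, 'w::ab_group_add) rrb"
    and iA :: "'b \<Rightarrow> 'e" and iV :: "'m \<Rightarrow> 'w"
    and pA :: "'e \<Rightarrow> 'a" and pV :: "'w \<Rightarrow> 'v"
    and sA :: "'a \<Rightarrow> 'e" and sV :: "'v \<Rightarrow> 'w"
  defines "rB \<equiv> ext_\<rho>B E iA sA" and "rM \<equiv> ext_\<rho>M E iV sA" and "mu \<equiv> ext_\<mu> E iA iV sV"
  defines "\<iota> \<equiv> \<iota>_map iA iV pA pV sA sV"
    and "K \<equiv> K_map iA iV pA pV sA sV"
    and "W \<equiv> Wells_map A B rB rM mu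
      (ext_\<omega> A E iA sA) (ext_varpi A E iV sA sV) (ext_\<chi> A E iA sA sV)"
  assumes "abelian_extension A B E iA iV pA pV"
    and "linear_section A E pA pV sA sV"
  shows "
    group (Z1 A B rB rM mu) \<and>
    group (Aut_ext E iA iV) \<and>
    group (compatible_pairs A B rB rM mu) \<and>
    B2 A B rB rM mu \<lhd> Z2 A B rB rM mu \<and>
    \<iota> \<in> hom (Z1 A B rB rM mu) (Aut_ext E iA iV) \<and>
    K \<in> hom (Aut_ext E iA iV) (compatible_pairs A B rB rM mu) \<and>
    W \<in> carrier (compatible_pairs A B rB rM mu) \<rightarrow> carrier (H2 A B rB rM mu) \<and>
    inj_on \<iota> (carrier (Z1 A B rB rM mu)) \<and>
    \<iota> ` carrier (Z1 A B rB rM mu) =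
      kernel (Aut_ext E iA iV) (compatible_pairs A B rB rM mu) K \<and>
    K ` carrier (Aut_ext E iA iV) =
      {c \<in> carrier (compatible_pairs A B rB rM mu). W c = \<one>\<^bsub>H2 A B rB rM mu\<^esub>}"
proof -
  interpret rrb_extension A B E iA iV pA pV sA sV
    by unfold_locales fact+
  show ?thesis
    unfolding assms(1-6)
    using group_Z1 group_Aut_ext group_compatible normal_B2 \<iota>_hom K_hom W_H2 inj_\<iota> image_\<iota> image_K
    by (auto intro: inj_on_subset)
qed

end
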